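(* Let $V:\mathbb{R}^n\to\mathbb{R}$ be a $\mathcal C^2$ function with $\int e^{-V}dx=1$, $\mathrm{Hess}(V)\ge R\,\mathrm{Id}_n$ with $R>0$, and such that for some constant $C$, $V(x+y)\le C(1+V(x)+V(y))$ for all $x,y\in\mathbb{R}^n$. Let $\mu$ be the probability measure with density $e^{-V}$. Let $u=(u_t)_{t\ge0}$ be a (gradient flow) solution of the Fokker-Planck equation $$\frac{\partial u_t}{\partial t}=\Delta u_t+\nabla\cdot(u_t\nabla V),\qquad t>0,\ x\in\mathbb{R}^n,$$ with initial condition $u_0\in P_2(\mathbb{R}^n)$. Let $T>0$ and assume that $u_t(|\nabla V|^2)\le M$ for all $t\in[0,T]$. Then there exists a constant $c>0$ depending only on $n$, $R$ and $M$ such that $$H(u_t|\mu)\le\max\Big\{1,\ \frac n2\log\frac ct\Big\},\qquad 0<t\le T.$$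
   Context: $P_2(\mathbb{R}^n)$ is the set of probability measures on $\mathbb{R}^n$ with finite second moment, with the Wasserstein distance $W_2$ (infimum over couplings $\pi$ of $(\iint|y-x|^2d\pi)^{1/2}$). $u_t(h)=\int h\,du_t$. For $\nu=f\mu$: $H(\nu|\mu)=\int f\log f\,d\mu$ and $I(\nu|\mu)=\int\frac{|\nabla f|^2}{f}d\mu$. Measures and their Lebesgue densities are denoted by the same letter. Solutions are the gradient flow solutions $u\in C([0,+\infty),P_2(\mathbb{R}^n))$ of the equation, i.e. the gradient flow of $H(\cdot|\mu)$ on $(P_2(\mathbb{R}^n),W_2)$ starting from $u_0$ in the sense of Ambrosio-Gigli-Savaré. Such a solution satisfies the equation in the sense of distributions; for any $t>0$, $u_t$ has a density; for almost every $t>0$ this density is in $W^{1,1}_{loc}(\mathbb{R}^n)$ with $\nabla u_t/u_t+\nabla V\in L^2(u_t)$; $t\mapsto I(u_t|\mu)$ is in $L^1_{loc}(]0,+\infty[)$ and $\frac{d}{dt}H(u_t|\mu)=-I(u_t|\mu)$ for almost every $t>0$. Moreover $u_t$ is the law of $X_t$, where $dX_t=\sqrt2\,dB_t-\nabla V(X_t)\,dt$ with $X_0$ of law $u_0$ and $(B_t)$ a standard Brownian motion on $\mathbb{R}^n$. *)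

theory Defs
  imports "HOL-Probability.Probability"
begin

definition grad :: "('a::euclidean_space \<Rightarrow> real) \<Rightarrow> 'a \<Rightarrow> 'a" where
  "grad V x = (THE g. GDERIV V x :> g)"

text \<open>The Hessian as a linear map: \<open>hess V x v\<close> is the derivative of the gradient
  at \<open>x\<close> in the direction \<open>v\<close>.\<close>

definition hess :: "('a::euclidean_space \<Rightarrow> real) \<Rightarrow> 'a \<Rightarrow> 'a \<Rightarrow> 'a" where
  "hess V x = frechet_derivative (grad V) (at x)"

text \<open>In finite dimension, continuity of \<open>hess V\<close> in operator norm is the same as continuity of
  \<open>\<lambda>x. hess V x v\<close> for every direction \<open>v\<close>.\<close>

definition C2_function :: "('a::euclidean_space \<Rightarrow> real) \<Rightarrow> bool" where
  "C2_function V \<longleftrightarrow>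
     (\<forall>x. V differentiable (at x)) \<and>
     (\<forall>x. grad V differentiable (at x)) \<and>
     (\<forall>v. continuous_on UNIV (\<lambda>x. hess V x v))"

definition P2 :: "'a::euclidean_space measure set" where
  "P2 = {\<nu>. prob_space \<nu> \<and> sets \<nu> = sets borel \<and> integrable \<nu> (\<lambda>x. (norm x)\<^sup>2)}"

definition couplings ::
  "'a::euclidean_space measure \<Rightarrow> 'a measure \<Rightarrow> ('a \<times> 'a) measure set" where
  "couplings \<mu> \<nu> =
     {\<pi>. sets \<pi> = sets (borel \<Otimes>\<^sub>M borel) \<and> distr \<pi> borel fst = \<mu> \<and> distr \<pi> borel snd = \<nu>}"

text \<open>Real-valued, hence meaningful only for \<open>\<mu>\<close> and \<open>\<nu>\<close> in \<open>P2\<close>: there the set of couplings is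
  nonempty and each of the integrals is finite.\<close>

definition W2 :: "'a::euclidean_space measure \<Rightarrow> 'a measure \<Rightarrow> real" where
  "W2 \<mu> \<nu> = (INF \<pi>\<in>couplings \<mu> \<nu>. sqrt (\<integral>(x, y). (norm (y - x))\<^sup>2 \<partial>\<pi>))"

text \<open>\<open>H(\<nu>|\<mu>)\<close> for \<open>\<nu> = f \<mu>\<close>, and \<open>\<infinity>\<close> if \<open>\<nu>\<close> is not absolutely continuous with respect to \<open>\<mu>\<close>.
  As \<open>f log f\<close> is bounded below and \<open>\<mu>\<close> is a probability measure, its integral is \<open>\<infinity>\<close> whenever it is
  not integrable.\<close>

definition rel_entropy :: "'a measure \<Rightarrow> 'a measure \<Rightarrow> ereal" where
  "rel_entropy \<nu> \<mu> =
     (let f = (\<lambda>x. enn2real (RN_deriv \<mu> \<nu> x)) in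
      if absolutely_continuous \<mu> \<nu> \<and> integrable \<mu> (\<lambda>x. f x * ln (f x))
      then ereal (\<integral>x. f x * ln (f x) \<partial>\<mu>) else \<infinity>)"

text \<open>Locally on the open half-line \<open>]0,\<infinity>[\<close>: nothing is required near \<open>t = 0\<close>.\<close>

definition loc_abs_continuous_curve :: "('p \<Rightarrow> 'p \<Rightarrow> real) \<Rightarrow> (real \<Rightarrow> 'p) \<Rightarrow> bool" where
  "loc_abs_continuous_curve d u \<longleftrightarrow>
     (\<exists>m :: real \<Rightarrow> real.
        (\<forall>a b. 0 < a \<and> a \<le> b \<longrightarrow> set_integrable lborel {a..b} m) \<and>
        (\<forall>s t. 0 < s \<and> s \<le> t \<longrightarrow> d (u s) (u t) \<le> (LINT r:{s..t}|lborel. m r)))"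

text \<open>Gradient flow, in the sense of Ambrosio, Gigli and Savare, of a \<open>\<lambda>\<close>-convex functional \<open>\<phi>\<close> on
  the metric space with points \<open>X\<close> and distance \<open>d\<close>: a curve in \<open>X\<close>, continuous on \<open>[0,\<infinity>[\<close> and
  locally absolutely continuous on \<open>]0,\<infinity>[\<close>, which for every \<open>v\<close> in the domain of \<open>\<phi>\<close> satisfies the
  evolution variational inequality
  \<open>1/2 d/dt d(u t, v)^2 + \<lambda>/2 d(u t, v)^2 + \<phi>(u t) \<le> \<phi>(v)\<close> for almost every \<open>t > 0\<close>.
  The flow starts from \<open>u 0\<close>. The parameter \<open>l\<close> below is \<open>\<lambda>\<close>.\<close>

definition gradient_flow ::
  "'p set \<Rightarrow> ('p \<Rightarrow> 'p \<Rightarrow> real) \<Rightarrow> ('p \<Rightarrow> ereal) \<Rightarrow> real \<Rightarrow> (real \<Rightarrow> 'p) \<Rightarrow> bool" where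
  "gradient_flow X d \<phi> l u \<longleftrightarrow>
     (\<forall>t\<ge>0. u t \<in> X) \<and>
     (\<forall>t\<ge>0. ((\<lambda>s. d (u s) (u t)) \<longlongrightarrow> 0) (at t within {0..})) \<and>
     loc_abs_continuous_curve d u \<and>
     (\<forall>v\<in>X. \<phi> v < \<infinity> \<longrightarrow>
        (AE t in lborel. 0 < t \<longrightarrow>
           (\<exists>D. ((\<lambda>s. 1/2 * (d (u s) v)\<^sup>2) has_real_derivative D) (at t) \<and>
                ereal (D + l/2 * (d (u t) v)\<^sup>2) + \<phi> (u t) \<le> \<phi> v)))"

definition gibbs :: "('a::euclidean_space \<Rightarrow> real) \<Rightarrow> 'a measure" where
  "gibbs V = density lborel (\<lambda>x. ennreal (exp (- V x)))"

text \<open>Gradient flow solutions of \<open>\<partial>\<^sub>t u = \<Delta> u + \<nabla> \<cdot> (u \<nabla>V)\<close> when the Hessian of \<open>V\<close> is bounded below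
  by \<open>R\<close>: then \<open>H(\<cdot>|\<mu>)\<close> is \<open>R\<close>-convex on the Wasserstein space.\<close>

definition fokker_planck_solution ::
  "('a::euclidean_space \<Rightarrow> real) \<Rightarrow> real \<Rightarrow> (real \<Rightarrow> 'a measure) \<Rightarrow> bool" where
  "fokker_planck_solution V R u \<longleftrightarrow>
     gradient_flow P2 W2 (\<lambda>\<nu>. rel_entropy \<nu> (gibbs V)) R u"

end

theory Submission
  imports Defs
begin

text \<open>
The evolution variational inequality compares the flow with every competitor \<open>v\<close>. Integrated over
\<open>[0,t]\<close>, and combined with the fact that \<open>H(\<cdot>|\<mu>)\<close> decreases along the flow, it gives
\<open>H(u\<^sub>t|\<mu>) \<le> H(v|\<mu>) + W\<^sub>2(u\<^sub>0,v)\<^sup>2 / (2t)\<close> (lemma \<open>gradient_flow_energy_le\<close>). The proof consists in choosing a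
good competitor: a measure at distance of order \<open>\<surd>t\<close> from \<open>u\<^sub>0\<close> whose entropy is at most
\<open>n/2 log(1/t)\<close> up to a constant.

Mollifying \<open>u\<^sub>0\<close> by a Gaussian would cost second derivatives of \<open>V\<close>, which have no upper bound. Instead
\<open>v\<close> is the law of \<open>(1-s) X + s Z\<close>, where \<open>X\<close> has law \<open>u\<^sub>0\<close> and \<open>Z\<close> is independent of \<open>X\<close> with law \<open>\<mu>\<close>.
Conditionally on \<open>X = x\<close> this is the image of \<open>\<mu>\<close> under a homothety of ratio \<open>s\<close>, so the logarithm of
its density relative to \<open>\<mu>\<close>, at the image of \<open>z\<close>, is
\<open>- n log s - V(z) + V((1-s) x + s z) \<le> - n log s + (1-s) (V(x) - V(z))\<close> by convexity of \<open>V\<close>. Strong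
convexity bounds \<open>V(x) - V(z)\<close> by \<open>|\<nabla>V(x)|\<^sup>2 / (2R)\<close>, hence
\<open>H(v|\<mu>) \<le> - n log s + (1-s) M / (2R)\<close> (lemma \<open>rel_entropy_interpolant_le\<close>).
On the other hand \<open>W\<^sub>2(u\<^sub>0,v)\<^sup>2 \<le> s\<^sup>2 E|X - Z|\<^sup>2 \<le> s\<^sup>2 K\<close> with \<open>K\<close> depending on \<open>n\<close>, \<open>R\<close>, \<open>M\<close> only (lemmas
\<open>W2_interpolant_le\<close> and \<open>mean_square_distance_to_gibbs\<close>). For \<open>t \<le> 1\<close> one takes \<open>s = \<surd>t\<close>; for \<open>t > 1\<close> one
takes \<open>s = 1\<close>, that is \<open>v = \<mu>\<close>, which gives \<open>H(u\<^sub>t|\<mu>) \<le> K / (2t)\<close>.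

Three general facts support this. The evolution variational inequality holds for almost every time
only, so passing to every time requires the lower semicontinuity of the entropy for \<open>W\<^sub>2\<close>, which
follows from the dual formula: \<open>H(\<nu>|\<mu>) \<le> c\<close> if and only if
\<open>\<integral>\<phi> d\<nu> \<le> c + log \<integral>e\<^sup>\<phi> d\<mu>\<close> for all bounded Lipschitz \<open>\<phi>\<close>. The same formula gives the entropy bound on
the competitor without computing its density. Secondly, integrating the inequality in time requires
\<open>t \<mapsto> W\<^sub>2(u\<^sub>t,v)\<^sup>2\<close> to be absolutely continuous, hence the triangle inequality for \<open>W\<^sub>2\<close>; it is obtained by
gluing couplings approximately, cell by cell, without disintegrating measures. Thirdly, a locally
absolutely continuous function whose derivative is at most \<open>B\<close> almost everywhere grows at rate at most
\<open>B\<close> (lemma \<open>le_if_AE_deriv_le\<close>).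
\<close>

section \<open>Functions with almost everywhere bounded derivative\<close>

text \<open>
The exceptional null set lies in an open set \<open>U\<close> of small measure for the density \<open>m\<close>. Near a point
outside the null set the increments of \<open>g\<close> are at most \<open>e\<close> times the length of the interval, near a
point of the null set they are at most the \<open>m\<close>-measure of a subinterval of \<open>U\<close>. Both bounds are
additive over adjacent intervals, so bisection assembles them to a bound on \<open>[a,b]\<close>.
\<close>

lemma nonincreasing_if_AE_deriv_nonpos:
  fixes g m :: "real \<Rightarrow> real"
  assumes ab: "a \<le> b" and m: "set_integrable lborel {a..b} m" and m0: "\<And>r. 0 \<le> m r"
    and ac: "\<And>s t. a \<le> s \<Longrightarrow> s \<le> t \<Longrightarrow> t \<le> b \<Longrightarrow> g t - g s \<le> (LINT r:{s..t}|lborel. m r)"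
    and deriv: "AE t in lborel. a < t \<and> t < b \<longrightarrow> (\<exists>D\<le>0. (g has_real_derivative D) (at t))"
  shows "g b \<le> g a"
proof -
  define M where "M = density lborel (\<lambda>r. ennreal (indicator {a..b} r * m r))"
  have mi: "integrable lborel (\<lambda>r. indicator {a..b} r * m r)"
    using m by (simp add: set_integrable_def)
  have [measurable]: "(\<lambda>r. indicator {a..b} r * m r) \<in> borel_measurable lborel"
    using mi by (rule borel_measurable_integrable)
  have eM: "emeasure M {s..t} = ennreal (LINT r:{s..t}|lborel. m r)" if "a \<le> s" "t \<le> b" for s t
  proof -
    have "emeasure M {s..t} = (\<integral>\<^sup>+r. ennreal (indicator {s..t} r * m r) \<partial>lborel)"
      unfolding M_def using that
      by (subst emeasure_density) (auto intro!: nn_integral_cong split: split_indicator)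
    also have "\<dots> = ennreal (LINT r:{s..t}|lborel. m r)"
      unfolding set_lebesgue_integral_def real_scaleR_def
    proof (rule nn_integral_eq_integral)
      have "set_integrable lborel {s..t} m"
        by (rule set_integrable_subset[OF m]) (use that in auto)
      then show "integrable lborel (\<lambda>r. indicator {s..t} r * m r)"
        by (simp add: set_integrable_def)
    qed (use m0 in auto)
    finally show ?thesis .
  qed
  have "emeasure M (space M) = emeasure M {a..b}"
    unfolding M_def by (subst (1 2) emeasure_density)
      (auto intro!: nn_integral_cong split: split_indicator)
  then have fin: "emeasure M (space M) \<noteq> \<infinity>" using eM[of a b] by simp
  interpret M: finite_measure M by standard (use fin in simp)
  have sM [simp, measurable_cong]: "sets M = sets borel" by (simp add: M_def)
  obtain N0 where N0: "N0 \<in> null_sets lborel"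
    and der: "\<And>t. t \<notin> N0 \<Longrightarrow> a < t \<Longrightarrow> t < b \<Longrightarrow> \<exists>D\<le>0. (g has_real_derivative D) (at t)"
    by (rule AE_E3[OF deriv]) auto
  \<comment> \<open>The derivative is controlled in the open interval only, so the end points join the exceptional set.\<close>
  define N where "N = N0 \<union> {a, b}"
  have N: "N \<in> null_sets lborel" unfolding N_def by (intro null_sets.Un N0 finite_imp_null_set_lborel) auto
  have "absolutely_continuous lborel M"
    unfolding M_def by (rule absolutely_continuousI_density) measurable
  then have NM: "emeasure M N = 0"
    using N unfolding absolutely_continuous_def by (auto simp: null_sets_def)
  have "g b - g a \<le> e * (b - a) + e" if e: "e > 0" for e
  proof -
    have "(INF U \<in> {U. N \<subseteq> U \<and> open U}. emeasure M U) < ennreal e"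
      using outer_regular[of M N] sM fin N NM e by (auto simp: null_sets_def)
    then obtain U where U: "N \<subseteq> U" "open U" "emeasure M U < ennreal e"
      unfolding INF_less_iff by auto
    have [measurable]: "U \<in> sets borel" using U by auto
    define P where "P s t \<longleftrightarrow> (a \<le> s \<longrightarrow> t \<le> b \<longrightarrow> g t - g s \<le> e * (t - s) + measure M ({s<..t} \<inter> U))" for s t
    have "P a b" using ab
    proof (induction rule: Bolzano)
      case (trans p q r)
      have "measure M ({p<..r} \<inter> U) = measure M ({p<..q} \<inter> U) + measure M ({q<..r} \<inter> U)"
        using trans by (subst M.finite_measure_Union[symmetric]) (auto intro!: arg_cong2[where f=measure])
      then show ?case using trans by (auto simp: P_def algebra_simps)
    next
      case (local x)
      show ?case
      proof (cases "x \<in> N")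
        case True
        then obtain d where d: "d > 0" "ball x d \<subseteq> U" using U by (meson openE subsetD)
        show ?thesis
        proof (intro exI[of _ d] conjI allI impI)
          fix s t assume st: "s \<le> x \<and> x \<le> t \<and> t - s < d"
          show "P s t" unfolding P_def
          proof (intro impI)
            assume ast: "a \<le> s" "t \<le> b"
            have sub: "{s..t} \<subseteq> U"
              using d st by (intro order_trans[OF _ d(2)]) (auto simp: dist_real_def)
            have "g t - g s \<le> (LINT r:{s..t}|lborel. m r)" using ac ast st by simp
            also have "\<dots> = measure M {s..t}"
              using eM[of s t] ast m0 unfolding measure_def
              by (simp add: set_lebesgue_integral_def)
            also have "\<dots> = measure M {s<..t}"
            proof -
              have "{s} \<in> null_sets M"
                using \<open>absolutely_continuous lborel M\<close> finite_imp_null_set_lborel[of "{s}"]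
                unfolding absolutely_continuous_def by auto
              then have "measure M {s} = 0" by (simp add: null_sets_def measure_def)
              moreover have "measure M {s..t} = measure M {s} + measure M {s<..t}"
                using st by (subst M.finite_measure_Union[symmetric]) (auto intro!: arg_cong2[where f=measure])
              ultimately show ?thesis by simp
            qed
            also have "\<dots> = measure M ({s<..t} \<inter> U)"
              using sub by (intro arg_cong2[where f=measure]) auto
            finally show "g t - g s \<le> e * (t - s) + measure M ({s<..t} \<inter> U)"
              using st e by (smt (verit) mult_nonneg_nonneg)
          qed
        qed (use d in auto)
      next
        case False
        then obtain D where D: "D \<le> 0" "(g has_real_derivative D) (at x)"
          using der[of x] local by (force simp: N_def)
        then obtain d where d: "d > 0"
          and dd: "\<And>y. \<bar>y - x\<bar> < d \<Longrightarrow> \<bar>g y - g x - D * (y - x)\<bar> \<le> e * \<bar>y - x\<bar>"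
          using e unfolding has_field_derivative_def has_derivative_within_alt
          by (auto simp: mult.commute)
        show ?thesis
        proof (intro exI[of _ d] conjI allI impI)
          fix s t assume st: "s \<le> x \<and> x \<le> t \<and> t - s < d"
          have "\<bar>g t - g x - D * (t - x)\<bar> \<le> e * (t - x)" "\<bar>g s - g x - D * (s - x)\<bar> \<le> e * (x - s)"
            using dd[of t] dd[of s] st by auto
          moreover have "D * (t - x) \<le> 0" "0 \<le> D * (s - x)"
            using D st by (auto simp: mult_nonpos_nonneg mult_nonpos_nonpos)
          ultimately have "g t - g s \<le> e * (t - s)" by (simp add: algebra_simps abs_le_iff)
          then show "P s t" unfolding P_def by (smt (verit) measure_nonneg)
        qed (use d in auto)
      qed
    qed
    then have "g b - g a \<le> e * (b - a) + measure M ({a<..b} \<inter> U)" by (simp add: P_def)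
    also have "measure M ({a<..b} \<inter> U) \<le> measure M U" by (rule M.finite_measure_mono) auto
    also have "\<dots> \<le> e" using U(3) e by (simp add: M.emeasure_eq_measure ennreal_less_iff)
    finally show ?thesis by simp
  qed
  note * = this
  have "g b - g a \<le> 0"
  proof (rule field_le_epsilon)
    fix e :: real assume "e > 0"
    then have "g b - g a \<le> e / (b - a + 1) * (b - a) + e / (b - a + 1)" using ab by (intro *) auto
    also have "\<dots> = e / (b - a + 1) * (b - a + 1)" by (simp only: distrib_left mult_1_right)
    also have "\<dots> = e" using ab by simp
    finally show "g b - g a \<le> 0 + e" by simp
  qed
  then show ?thesis by simp
qed

lemma le_if_AE_deriv_le:
  fixes g m :: "real \<Rightarrow> real"
  assumes ab: "a \<le> b" and m: "set_integrable lborel {a..b} m"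
    and ac: "\<And>s t. a \<le> s \<Longrightarrow> s \<le> t \<Longrightarrow> t \<le> b \<Longrightarrow> g t - g s \<le> (LINT r:{s..t}|lborel. m r)"
    and deriv: "AE t in lborel. a < t \<and> t < b \<longrightarrow> (\<exists>D\<le>B. (g has_real_derivative D) (at t))"
  shows "g b - g a \<le> B * (b - a)"
proof -
  \<comment> \<open>Subtracting \<open>B t\<close> reduces to \<open>B = 0\<close>; the modulus of continuity grows by \<open>\<bar>B\<bar>\<close>.\<close>
  define G where "G t = g t - B * t" for t
  define k where "k r = \<bar>m r\<bar> + \<bar>B\<bar>" for r
  have kc: "set_integrable lborel {s..t} (\<lambda>_. \<bar>B\<bar>)" for s t :: real
    unfolding set_integrable_def real_scaleR_def
    by (intro integrable_mult_left integrable_real_indicator) (auto simp: emeasure_lborel_Icc_eq)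
  have ms: "set_integrable lborel {s..t} m" if "a \<le> s" "t \<le> b" for s t
    by (rule set_integrable_subset[OF m]) (use that in auto)
  have ki: "set_integrable lborel {s..t} k" if "a \<le> s" "t \<le> b" for s t
    unfolding k_def by (intro set_integral_add set_integrable_abs ms kc that)
  have "G b \<le> G a"
  proof (rule nonincreasing_if_AE_deriv_nonpos[OF ab, where m=k])
    show "set_integrable lborel {a..b} k" using ki[of a b] by simp
    fix s t assume st: "a \<le> s" "s \<le> t" "t \<le> b"
    have "G t - G s \<le> (LINT r:{s..t}|lborel. m r) + \<bar>B\<bar> * (t - s)"
      using ac[OF st] st abs_ge_minus_self[of B] mult_right_mono[of "-B" "\<bar>B\<bar>" "t - s"]
      by (simp add: G_def algebra_simps)
    also have "\<bar>B\<bar> * (t - s) = (LINT r:{s..t}|lborel. \<bar>B\<bar>)"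
      using st by (simp add: set_lebesgue_integral_def)
    also have "(LINT r:{s..t}|lborel. m r) + (LINT r:{s..t}|lborel. \<bar>B\<bar>)
        = (LINT r:{s..t}|lborel. m r + \<bar>B\<bar>)"
      using st by (intro set_integral_add(2)[symmetric] ms kc)
    also have "\<dots> \<le> (LINT r:{s..t}|lborel. k r)"
      using st by (intro set_integral_mono ki set_integral_add ms kc) (auto simp: k_def)
    finally show "G t - G s \<le> (LINT r:{s..t}|lborel. k r)" .
  next
    show "AE t in lborel. a < t \<and> t < b \<longrightarrow> (\<exists>D\<le>0. (G has_real_derivative D) (at t))"
      using deriv
    proof eventually_elim
      case (elim t)
      show ?case
      proof
        assume "a < t \<and> t < b"
        then obtain D where "D \<le> B" "(g has_real_derivative D) (at t)" using elim by auto
        moreover from this have "(G has_real_derivative D - B) (at t)"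
          unfolding G_def[abs_def] by (auto intro!: derivative_eq_intros)
        ultimately show "\<exists>D\<le>0. (G has_real_derivative D) (at t)"
          by (intro exI[of _ "D - B"]) auto
      qed
    qed
  qed (auto simp: k_def)
  then show ?thesis by (simp add: G_def algebra_simps)
qed

section \<open>Evolution variational inequalities\<close>

text \<open>
The squared distance to \<open>v\<close> is locally absolutely continuous because \<open>d(u\<^sub>t,v)\<close> is locally bounded and
varies no faster than the curve itself. The term with \<open>l\<close> has a favourable sign and is dropped.
\<close>

lemma EVI_integrated:
  fixes u :: "real \<Rightarrow> 'p"
  assumes gf: "gradient_flow X d \<phi> l u" and l: "0 \<le> l"
    and nonneg: "\<And>x y. x \<in> X \<Longrightarrow> y \<in> X \<Longrightarrow> 0 \<le> d x y"
    and sym: "\<And>x y. x \<in> X \<Longrightarrow> y \<in> X \<Longrightarrow> d x y = d y x"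
    and triangle: "\<And>x y z. x \<in> X \<Longrightarrow> y \<in> X \<Longrightarrow> z \<in> X \<Longrightarrow> d x z \<le> d x y + d y z"
    and v: "v \<in> X" "\<phi> v \<le> ereal e" and ab: "0 < a" "a \<le> b"
    and above: "\<And>r. a < r \<Longrightarrow> r < b \<Longrightarrow> ereal c < \<phi> (u r)"
  shows "1/2 * (d (u b) v)\<^sup>2 - 1/2 * (d (u a) v)\<^sup>2 \<le> (e - c) * (b - a)"
proof -
  have uX: "u r \<in> X" if "0 \<le> r" for r
    using gf that by (auto simp: gradient_flow_def)
  obtain m where mi: "\<And>a b. 0 < a \<Longrightarrow> a \<le> b \<Longrightarrow> set_integrable lborel {a..b} m"
    and dm: "\<And>s t. 0 < s \<Longrightarrow> s \<le> t \<Longrightarrow> d (u s) (u t) \<le> (LINT r:{s..t}|lborel. m r)"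
    using gf unfolding gradient_flow_def loc_abs_continuous_curve_def by blast
  define K where "K = d (u a) v + (LINT r:{a..b}|lborel. \<bar>m r\<bar>)"
  have K: "d (u t) v \<le> K" if "a \<le> t" "t \<le> b" for t
  proof -
    have mt: "set_integrable lborel {a..t} m" and mb: "set_integrable lborel {a..b} m"
      using mi ab that by auto
    have "d (u t) v \<le> d (u t) (u a) + d (u a) v"
      using ab that v by (intro triangle uX) auto
    also have "d (u t) (u a) = d (u a) (u t)" using ab that by (intro sym uX) auto
    also have "\<dots> \<le> (LINT r:{a..t}|lborel. m r)" using dm ab that by auto
    also have "\<dots> \<le> (LINT r:{a..b}|lborel. \<bar>m r\<bar>)"
      unfolding set_lebesgue_integral_def
      using mt set_integrable_abs[OF mb] that unfolding set_integrable_def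
      by (intro integral_mono) (auto split: split_indicator)
    finally show ?thesis by (simp add: K_def)
  qed
  show ?thesis
  proof (rule le_if_AE_deriv_le[where m="\<lambda>r. K * m r", OF ab(2)])
    show "set_integrable lborel {a..b} (\<lambda>r. K * m r)"
      using mi[OF ab] by (rule set_integrable_mult_right)
    fix s t assume st: "a \<le> s" "s \<le> t" "t \<le> b"
    have X: "u s \<in> X" "u t \<in> X" using st ab uX by auto
    have "d (u t) v - d (u s) v \<le> d (u s) (u t)"
      using triangle[of "u t" "u s" v] sym[of "u t" "u s"] X v by simp
    then have "(d (u t) v - d (u s) v) * (d (u t) v + d (u s) v) \<le> d (u s) (u t) * (2 * K)"
      using K[of s] K[of t] st nonneg X v by (intro mult_mono) (auto intro!: add_nonneg_nonneg)
    moreover have "d (u s) (u t) * (2 * K) \<le> (LINT r:{s..t}|lborel. m r) * (2 * K)"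
      using dm[of s t] st ab K[of s] nonneg[of "u s" v] X v by (intro mult_right_mono) auto
    ultimately show "1/2 * (d (u t) v)\<^sup>2 - 1/2 * (d (u s) v)\<^sup>2 \<le> (LINT r:{s..t}|lborel. K * m r)"
      by (simp add: power2_eq_square algebra_simps)
  next
    have "\<phi> v < \<infinity>" using le_less_trans[OF v(2), of \<infinity>] by simp
    then have "AE t in lborel. 0 < t \<longrightarrow>
           (\<exists>D. ((\<lambda>s. 1/2 * (d (u s) v)\<^sup>2) has_real_derivative D) (at t) \<and>
                ereal (D + l/2 * (d (u t) v)\<^sup>2) + \<phi> (u t) \<le> \<phi> v)"
      using gf v(1) unfolding gradient_flow_def by blast
    then show "AE t in lborel. a < t \<and> t < b \<longrightarrow>
        (\<exists>D\<le>e - c. ((\<lambda>s. 1/2 * (d (u s) v)\<^sup>2) has_real_derivative D) (at t))"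
    proof eventually_elim
      case (elim t)
      show ?case
      proof
        assume t: "a < t \<and> t < b"
        then obtain D where D: "((\<lambda>s. 1/2 * (d (u s) v)\<^sup>2) has_real_derivative D) (at t)"
          and le: "ereal (D + l/2 * (d (u t) v)\<^sup>2) + \<phi> (u t) \<le> \<phi> v"
          using elim ab by auto
        have "ereal (D + l/2 * (d (u t) v)\<^sup>2) + \<phi> (u t) \<le> ereal e" using le v(2) by (rule order_trans)
        moreover have "ereal c < \<phi> (u t)" using above t by simp
        ultimately have "D + l/2 * (d (u t) v)\<^sup>2 + c \<le> e"
          by (cases "\<phi> (u t)") auto
        moreover have "0 \<le> l/2 * (d (u t) v)\<^sup>2" using l by simp
        ultimately have "D \<le> e - c" by linarith
        with D show "\<exists>D\<le>e - c. ((\<lambda>s. 1/2 * (d (u s) v)\<^sup>2) has_real_derivative D) (at t)" by blast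
      qed
    qed
  qed
qed

text \<open>
The energy is nonincreasing along the flow, in the following form: if it exceeds \<open>c\<close> at time \<open>t\<close>, then
it exceeds \<open>c\<close> at all earlier times. Otherwise lower semicontinuity provides a last time \<open>q < t\<close> at which
it is at most \<open>c\<close>. The inequality with competitor \<open>u\<^sub>q\<close> forces the curve to stay at \<open>u\<^sub>q\<close> on \<open>[q,t[\<close>, and
read again for this constant curve it says that the energy is at most \<open>c\<close> at almost every time of this
interval, against the choice of \<open>q\<close>.
Knowing that the energy exceeds \<open>c\<close> on the whole of \<open>]0,t]\<close>, one integrates the inequality with competitor
\<open>v\<close> down to time \<open>0\<close>.
\<close>

theorem gradient_flow_energy_le:
  fixes u :: "real \<Rightarrow> 'p"
  assumes gf: "gradient_flow X d \<phi> l u" and l: "0 \<le> l"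
    and nonneg: "\<And>x y. x \<in> X \<Longrightarrow> y \<in> X \<Longrightarrow> 0 \<le> d x y"
    and refl: "\<And>x. x \<in> X \<Longrightarrow> d x x = 0"
    and sym: "\<And>x y. x \<in> X \<Longrightarrow> y \<in> X \<Longrightarrow> d x y = d y x"
    and triangle: "\<And>x y z. x \<in> X \<Longrightarrow> y \<in> X \<Longrightarrow> z \<in> X \<Longrightarrow> d x z \<le> d x y + d y z"
    and lsc: "\<And>x y c. (\<And>n. x n \<in> X) \<Longrightarrow> y \<in> X \<Longrightarrow> (\<lambda>n::nat. d (x n) y) \<longlonglongrightarrow> 0
       \<Longrightarrow> (\<And>n. \<phi> (x n) \<le> ereal c) \<Longrightarrow> \<phi> y \<le> ereal c"
    and v: "v \<in> X" "\<phi> v \<le> ereal e" and t: "0 < t"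
  shows "\<phi> (u t) \<le> ereal (e + (d (u 0) v)\<^sup>2 / (2 * t))"
proof (rule ccontr)
  note integrated = EVI_integrated[OF gf l nonneg sym triangle]
  have uX: "u r \<in> X" if "0 \<le> r" for r
    using gf that by (auto simp: gradient_flow_def)
  have cont: "((\<lambda>s. d (u s) (u r)) \<longlongrightarrow> 0) (at r within {0..})" if "0 \<le> r" for r
    using gf that by (auto simp: gradient_flow_def)
  assume "\<not> ?thesis"
  then obtain c where c: "e + (d (u 0) v)\<^sup>2 / (2 * t) < c" "ereal c < \<phi> (u t)"
    using ereal_dense2[of "ereal (e + (d (u 0) v)\<^sup>2 / (2 * t))" "\<phi> (u t)"]
    by (auto simp: not_le)
  have above: "ereal c < \<phi> (u r)" if r: "0 < r" "r \<le> t" for r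
  proof (rule ccontr)
    assume neg: "\<not> ereal c < \<phi> (u r)"
    define S where "S = {q \<in> {r..t}. \<phi> (u q) \<le> ereal c}"
    have "closed S"
      unfolding closed_sequential_limits
    proof (intro allI impI, elim conjE)
      fix x y assume x: "\<forall>n. x n \<in> S" and lim: "x \<longlonglongrightarrow> y"
      have "y \<in> {r..t}"
        by (rule closed_sequentially[OF closed_atLeastAtMost _ lim]) (use x in \<open>auto simp: S_def\<close>)
      then have y: "r \<le> y" "y \<le> t" by auto
      have "continuous (at y within {0..}) (\<lambda>s. d (u s) (u y))"
        using cont[of y] refl[OF uX[of y]] y r unfolding continuous_within by simp
      moreover have xn: "\<forall>n. x n \<in> {0..}"
      proof
        fix n
        have "r \<le> x n" using x by (simp add: S_def)
        then show "x n \<in> {0..}" using r by simp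
      qed
      ultimately have conv: "(\<lambda>n. d (u (x n)) (u y)) \<longlonglongrightarrow> 0"
        using lim refl[OF uX[of y]] y r unfolding continuous_within_sequentially by (auto simp: o_def)
      have "\<phi> (u y) \<le> ereal c"
        by (rule lsc[OF _ _ conv]) (use x xn y r uX in \<open>auto simp: S_def\<close>)
      then show "y \<in> S" using y by (auto simp: S_def)
    qed
    moreover have "S \<noteq> {}" using neg r by (auto simp: S_def)
    moreover have bdd: "bdd_above S" by (auto simp: S_def)
    ultimately have "Sup S \<in> S" by (intro closed_contains_Sup)
    define q where "q = Sup S"
    have q: "r \<le> q" "q \<le> t" "\<phi> (u q) \<le> ereal c"
      using \<open>Sup S \<in> S\<close> by (auto simp: S_def q_def)
    have "q < t" using q c(2) by (metis leD order_le_imp_less_or_eq)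
    have q0: "0 < q" using q r by simp
    have high: "ereal c < \<phi> (u p)" if "q < p" "p \<le> t" for p
    proof (rule ccontr)
      assume "\<not> ereal c < \<phi> (u p)"
      then have "p \<in> S" using that q by (auto simp: S_def)
      then have "p \<le> q" unfolding q_def using bdd by (rule cSup_upper)
      then show False using that by simp
    qed
    \<comment> \<open>From time \<open>q\<close> on the distance to \<open>u q\<close> cannot grow, so the curve stands still.\<close>
    have zero: "d (u p) (u q) = 0" if p: "q < p" "p < t" for p
    proof -
      have "1/2 * (d (u p) (u q))\<^sup>2 - 1/2 * (d (u q) (u q))\<^sup>2 \<le> (c - c) * (p - q)"
        using q q0 p high by (intro integrated uX) auto
      then show ?thesis using refl[OF uX[of q]] q0 by simp
    qed
    have "\<phi> (u q) < \<infinity>" using le_less_trans[OF q(3), of \<infinity>] by simp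
    then have "AE p in lborel. 0 < p \<longrightarrow>
           (\<exists>D. ((\<lambda>s. 1/2 * (d (u s) (u q))\<^sup>2) has_real_derivative D) (at p) \<and>
                ereal (D + l/2 * (d (u p) (u q))\<^sup>2) + \<phi> (u p) \<le> \<phi> (u q))"
      using gf uX[of q] q0 unfolding gradient_flow_def by auto
    then have "AE p in lborel. p \<notin> {q<..<t}"
    proof eventually_elim
      case (elim p)
      show ?case
      proof
        assume p: "p \<in> {q<..<t}"
        then obtain D where D: "((\<lambda>s. 1/2 * (d (u s) (u q))\<^sup>2) has_real_derivative D) (at p)"
          and le: "ereal (D + l/2 * (d (u p) (u q))\<^sup>2) + \<phi> (u p) \<le> \<phi> (u q)"
          using elim q0 by auto
        have "((\<lambda>s. 0) has_real_derivative D) (at p)"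
          by (rule has_field_derivative_transform_within_open[OF D, of "{q<..<t}"])
            (use p zero in auto)
        then have "D = 0" using DERIV_unique[OF _ DERIV_const] by blast
        then have "\<phi> (u p) \<le> ereal c" using le q(3) zero[of p] p by simp
        then show False using high[of p] p by auto
      qed
    qed
    then have "emeasure lborel {q<..<t} = 0"
      by (subst (asm) AE_iff_measurable[where N="{q<..<t}"]) auto
    then show False using \<open>q < t\<close> by simp
  qed
  have ineq: "0 \<le> 1/2 * (d (u s) (u 0) + d (u 0) v)\<^sup>2 + (e - c) * (t - s)" if s: "0 < s" "s < t" for s
  proof -
    have "1/2 * (d (u t) v)\<^sup>2 - 1/2 * (d (u s) v)\<^sup>2 \<le> (e - c) * (t - s)"
      using s v above by (intro integrated) auto
    moreover have "(d (u s) v)\<^sup>2 \<le> (d (u s) (u 0) + d (u 0) v)\<^sup>2"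
      using s v by (intro power_mono triangle nonneg uX) auto
    moreover have "0 \<le> (d (u t) v)\<^sup>2" by simp
    ultimately show ?thesis by linarith
  qed
  have "((\<lambda>s. d (u s) (u 0)) \<longlongrightarrow> 0) (at_right 0)"
    by (rule tendsto_within_subset[OF cont[of 0]]) auto
  then have "((\<lambda>s. 1/2 * (d (u s) (u 0) + d (u 0) v)\<^sup>2 + (e - c) * (t - s)) \<longlongrightarrow>
      1/2 * (0 + d (u 0) v)\<^sup>2 + (e - c) * (t - 0)) (at_right 0)"
    by (intro tendsto_intros)
  moreover have "\<forall>\<^sub>F s in at_right 0. 0 \<le> 1/2 * (d (u s) (u 0) + d (u 0) v)\<^sup>2 + (e - c) * (t - s)"
    using eventually_at_right_real[OF t] by eventually_elim (use ineq in auto)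
  ultimately have "0 \<le> 1/2 * (0 + d (u 0) v)\<^sup>2 + (e - c) * (t - 0)"
    by (intro tendsto_lowerbound) auto
  then have "c \<le> e + (d (u 0) v)\<^sup>2 / (2 * t)" using t by (simp add: field_simps)
  then show False using c(1) by simp
qed

section \<open>Bounded Lipschitz functions\<close>

text \<open>
Clipping keeps approximating functions within the bounds of the function that they approximate.
\<close>

lemma lipschitz_on_clip:
  fixes \<psi> :: "'a::metric_space \<Rightarrow> real"
  assumes "L-lipschitz_on UNIV \<psi>"
  shows "L-lipschitz_on UNIV (\<lambda>x. max a (min b (\<psi> x)))"
proof (rule lipschitz_onI)
  fix x y
  have "\<bar>max a (min b (\<psi> x)) - max a (min b (\<psi> y))\<bar> \<le> \<bar>\<psi> x - \<psi> y\<bar>" by linarith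
  also have "\<dots> \<le> L * dist x y" using lipschitz_onD[OF assms, of x y] by (simp add: dist_real_def)
  finally show "dist (max a (min b (\<psi> x))) (max a (min b (\<psi> y))) \<le> L * dist x y"
    by (simp add: dist_real_def)
qed (rule lipschitz_on_nonneg[OF assms])

lemma borel_measurable_lipschitz:
  fixes \<psi> :: "'a::metric_space \<Rightarrow> real"
  assumes "L-lipschitz_on UNIV \<psi>" shows "\<psi> \<in> borel_measurable borel"
  using lipschitz_on_continuous_on[OF assms] by (rule borel_measurable_continuous_onI)

text \<open>
The approximations are \<open>1 - j d(x,F)\<close> clipped to \<open>[0,1]\<close>. The empty set is treated apart, since the
distance to it is \<open>0\<close> by convention.
\<close>

lemma closed_indicator_lipschitz_limit:
  fixes F :: "'a::metric_space set"
  assumes F: "closed F"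
  obtains \<psi> :: "nat \<Rightarrow> 'a \<Rightarrow> real" where
    "\<And>j. (real j)-lipschitz_on UNIV (\<psi> j)" "\<And>j x. 0 \<le> \<psi> j x" "\<And>j x. \<psi> j x \<le> 1"
    "\<And>x. (\<lambda>j. \<psi> j x) \<longlonglongrightarrow> indicator F x"
proof (cases "F = {}")
  case True
  show ?thesis by (rule that[of "\<lambda>_ _. 0"]) (auto simp: True intro: lipschitz_onI)
next
  case False
  define \<psi> where "\<psi> j x = max 0 (min 1 (1 - real j * infdist x F))" for j :: nat and x
  show ?thesis
  proof (rule that[of \<psi>])
    fix j
    have "(real j)-lipschitz_on UNIV (\<lambda>x. 1 - real j * infdist x F)"
    proof (rule lipschitz_onI)
      fix x y :: 'a
      have "\<bar>real j * infdist x F - real j * infdist y F\<bar> = real j * \<bar>infdist x F - infdist y F\<bar>"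
        by (simp add: abs_mult flip: right_diff_distrib)
      also have "\<dots> \<le> real j * dist x y" by (intro mult_left_mono infdist_triangle_abs) auto
      finally show "dist (1 - real j * infdist x F) (1 - real j * infdist y F) \<le> real j * dist x y"
        by (simp add: dist_real_def)
    qed simp
    then show "(real j)-lipschitz_on UNIV (\<psi> j)" unfolding \<psi>_def by (rule lipschitz_on_clip)
  next
    fix x
    show "(\<lambda>j. \<psi> j x) \<longlonglongrightarrow> indicator F x"
    proof (cases "x \<in> F")
      case True
      then show ?thesis by (simp add: \<psi>_def)
    next
      case xF: False
      then have pos: "infdist x F > 0" using F False by (simp add: infdist_pos_not_in_closed)
      then have "\<forall>\<^sub>F j in sequentially. 1 / infdist x F \<le> real j"
        using filterlim_real_sequentially unfolding filterlim_at_top by blast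
      then have "\<forall>\<^sub>F j in sequentially. \<psi> j x = indicator F x"
      proof eventually_elim
        case (elim j)
        then have "1 \<le> real j * infdist x F" using pos by (simp add: field_simps)
        then show ?case using xF by (simp add: \<psi>_def)
      qed
      then show ?thesis by (rule tendsto_eventually)
    qed
  qed (auto simp: \<psi>_def)
qed

text \<open>
By linearity and passage to the limit it is enough to approximate indicators, which inner regularity
reduces to indicators of compact sets.
\<close>

lemma lipschitz_dense_L1:
  fixes \<mu> :: "'a::euclidean_space measure" and f :: "'a \<Rightarrow> real"
  assumes fin: "finite_measure \<mu>" and [measurable_cong]: "sets \<mu> = sets borel"
    and f: "integrable \<mu> f" and \<epsilon>: "0 < \<epsilon>"
  shows "\<exists>\<psi> L. L-lipschitz_on UNIV \<psi> \<and> integrable \<mu> \<psi> \<and> (\<integral>x. \<bar>f x - \<psi> x\<bar> \<partial>\<mu>) < \<epsilon>"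
  using f \<epsilon>
proof (induction arbitrary: \<epsilon> rule: integrable_induct)
  case (base A c)
  interpret finite_measure \<mu> by fact
  define \<delta> where "\<delta> = \<epsilon> / (\<bar>c\<bar> + 1)"
  have \<delta>: "\<delta> > 0" using base by (simp add: \<delta>_def)
  have [measurable]: "A \<in> sets borel" using base assms(2) by simp
  have "\<exists>K. K \<subseteq> A \<and> compact K \<and> measure \<mu> A - \<delta> < measure \<mu> K"
  proof (cases "measure \<mu> A - \<delta> < 0")
    case True
    then show ?thesis by (intro exI[of _ "{}"]) auto
  next
    case False
    have "ennreal (measure \<mu> A - \<delta>) < emeasure \<mu> A"
      using False \<delta> by (simp add: emeasure_eq_measure ennreal_less_iff)
    also have "\<dots> = (SUP K \<in> {K. K \<subseteq> A \<and> compact K}. emeasure \<mu> K)"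
      by (rule inner_regular) (use assms in auto)
    finally show ?thesis using False
      by (auto simp: less_SUP_iff emeasure_eq_measure ennreal_less_iff)
  qed
  then obtain K where K: "K \<subseteq> A" "compact K" "measure \<mu> A - \<delta> < measure \<mu> K" by blast
  have [measurable]: "K \<in> sets borel" using K by (simp add: compact_imp_closed)
  obtain \<psi> :: "nat \<Rightarrow> 'a \<Rightarrow> real" where \<psi>: "\<And>j. (real j)-lipschitz_on UNIV (\<psi> j)"
      "\<And>j x. 0 \<le> \<psi> j x" "\<And>j x. \<psi> j x \<le> 1"
      "\<And>x. (\<lambda>j. \<psi> j x) \<longlonglongrightarrow> indicator K x"
    using closed_indicator_lipschitz_limit[OF compact_imp_closed[OF K(2)]] by blast
  have [measurable]: "\<psi> j \<in> borel_measurable borel" for j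
    by (rule borel_measurable_lipschitz[OF \<psi>(1)])
  have int\<psi>: "integrable \<mu> (\<psi> j)" for j
    by (rule integrable_const_bound[where B=1]) (use \<psi> in auto)
  have "(\<lambda>j. \<integral>x. \<bar>indicator A x - \<psi> j x\<bar> \<partial>\<mu>) \<longlonglongrightarrow> (\<integral>x. \<bar>indicator A x - indicator K x\<bar> \<partial>\<mu>)"
  proof (rule integral_dominated_convergence[where w="\<lambda>_. 1"])
    show "AE x in \<mu>. (\<lambda>j. \<bar>indicator A x - \<psi> j x\<bar>) \<longlonglongrightarrow> \<bar>indicat_real A x - indicator K x\<bar>"
      by (intro AE_I2 tendsto_intros \<psi>)
    show "AE x in \<mu>. norm \<bar>indicat_real A x - \<psi> j x\<bar> \<le> 1" for j
      using \<psi>(2,3)[of j] by (intro AE_I2) (simp split: split_indicator)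
  qed auto
  moreover have "(\<integral>x. \<bar>indicat_real A x - indicator K x\<bar> \<partial>\<mu>) = (\<integral>x. indicat_real A x - indicator K x \<partial>\<mu>)"
    using K by (intro Bochner_Integration.integral_cong) (auto split: split_indicator)
  moreover have "\<dots> = measure \<mu> A - measure \<mu> K"
    by (subst Bochner_Integration.integral_diff)
      (auto simp: integrable_real_indicator emeasure_finite less_top[symmetric])
  ultimately have "(\<lambda>j. \<integral>x. \<bar>indicator A x - \<psi> j x\<bar> \<partial>\<mu>) \<longlonglongrightarrow> measure \<mu> A - measure \<mu> K" by simp
  then have "\<forall>\<^sub>F j in sequentially. (\<integral>x. \<bar>indicator A x - \<psi> j x\<bar> \<partial>\<mu>) < \<delta>"
    by (rule order_tendstoD) (use K in simp)
  then obtain j where j: "(\<integral>x. \<bar>indicator A x - \<psi> j x\<bar> \<partial>\<mu>) < \<delta>"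
    by (auto simp: eventually_sequentially)
  have "(\<integral>x. \<bar>indicator A x *\<^sub>R c - c * \<psi> j x\<bar> \<partial>\<mu>) = (\<integral>x. \<bar>c\<bar> * \<bar>indicator A x - \<psi> j x\<bar> \<partial>\<mu>)"
    by (intro Bochner_Integration.integral_cong) (auto simp: algebra_simps simp flip: abs_mult)
  also have "\<dots> = \<bar>c\<bar> * (\<integral>x. \<bar>indicator A x - \<psi> j x\<bar> \<partial>\<mu>)" by simp
  also have "\<dots> \<le> \<bar>c\<bar> * \<delta>" using j by (intro mult_left_mono) auto
  also have "\<dots> < \<epsilon>" using base by (simp add: \<delta>_def field_simps)
  finally have "(\<integral>x. \<bar>indicator A x *\<^sub>R c - c * \<psi> j x\<bar> \<partial>\<mu>) < \<epsilon>" .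
  moreover have "(\<bar>c\<bar> * real j)-lipschitz_on UNIV (\<lambda>x. c * \<psi> j x)"
    by (rule lipschitz_on_cmult_real[OF \<psi>(1)])
  ultimately show ?case using int\<psi> by (intro exI[of _ "\<lambda>x. c * \<psi> j x"]) auto
next
  case (add f g)
  obtain \<psi> L \<psi>' L' where *: "L-lipschitz_on UNIV \<psi>" "integrable \<mu> \<psi>" "(\<integral>x. \<bar>f x - \<psi> x\<bar> \<partial>\<mu>) < \<epsilon>/2"
      "L'-lipschitz_on UNIV \<psi>'" "integrable \<mu> \<psi>'" "(\<integral>x. \<bar>g x - \<psi>' x\<bar> \<partial>\<mu>) < \<epsilon>/2"
    using add.IH[of "\<epsilon>/2"] add.prems by auto
  have "(\<integral>x. \<bar>f x + g x - (\<psi> x + \<psi>' x)\<bar> \<partial>\<mu>) \<le> (\<integral>x. \<bar>f x - \<psi> x\<bar> + \<bar>g x - \<psi>' x\<bar> \<partial>\<mu>)"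
    using * add.hyps by (intro integral_mono) auto
  also have "\<dots> = (\<integral>x. \<bar>f x - \<psi> x\<bar> \<partial>\<mu>) + (\<integral>x. \<bar>g x - \<psi>' x\<bar> \<partial>\<mu>)"
    using * add.hyps by simp
  finally show ?case using *
    by (intro exI[of _ "\<lambda>x. \<psi> x + \<psi>' x"] exI[of _ "L + L'"]) (auto intro: lipschitz_on_add)
next
  case (lim f s)
  have "(\<lambda>i. \<integral>x. \<bar>f x - s i x\<bar> \<partial>\<mu>) \<longlonglongrightarrow> (\<integral>x. 0 \<partial>\<mu>)"
  proof (rule integral_dominated_convergence[where w="\<lambda>x. 3 * \<bar>f x\<bar>"])
    show "AE x in \<mu>. (\<lambda>i. \<bar>f x - s i x\<bar>) \<longlonglongrightarrow> 0"
    proof (rule AE_I2)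
      fix x assume "x \<in> space \<mu>"
      from tendsto_rabs[OF tendsto_diff[OF tendsto_const lim.hyps(2)[OF this]], of "f x"]
      show "(\<lambda>i. \<bar>f x - s i x\<bar>) \<longlonglongrightarrow> 0" by simp
    qed
    show "AE x in \<mu>. norm \<bar>f x - s i x\<bar> \<le> 3 * \<bar>f x\<bar>" for i
    proof (rule AE_I2)
      fix x assume "x \<in> space \<mu>"
      from lim.hyps(3)[OF this, of i] show "norm \<bar>f x - s i x\<bar> \<le> 3 * \<bar>f x\<bar>"
        unfolding real_norm_def by linarith
    qed
  qed (use lim.hyps(1,4) in auto)
  then have "\<forall>\<^sub>F i in sequentially. (\<integral>x. \<bar>f x - s i x\<bar> \<partial>\<mu>) < \<epsilon>/2"
    by (rule order_tendstoD) (use lim.prems in simp)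
  then obtain i where i: "(\<integral>x. \<bar>f x - s i x\<bar> \<partial>\<mu>) < \<epsilon>/2"
    by (auto simp: eventually_sequentially)
  obtain \<psi> L where *: "L-lipschitz_on UNIV \<psi>" "integrable \<mu> \<psi>" "(\<integral>x. \<bar>s i x - \<psi> x\<bar> \<partial>\<mu>) < \<epsilon>/2"
    using lim.IH[of "\<epsilon>/2" i] lim.prems by auto
  have "(\<integral>x. \<bar>f x - \<psi> x\<bar> \<partial>\<mu>) \<le> (\<integral>x. \<bar>f x - s i x\<bar> + \<bar>s i x - \<psi> x\<bar> \<partial>\<mu>)"
    using * lim.hyps(1)[of i] lim.hyps(4) by (intro integral_mono) auto
  also have "\<dots> = (\<integral>x. \<bar>f x - s i x\<bar> \<partial>\<mu>) + (\<integral>x. \<bar>s i x - \<psi> x\<bar> \<partial>\<mu>)"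
    using * lim.hyps(1)[of i] lim.hyps(4) by simp
  finally show ?case using * i by (intro exI[of _ \<psi>] exI[of _ L]) auto
qed

section \<open>Variational formula for the relative entropy\<close>

text \<open>
The entropy is defined through the real-valued density; nothing is lost in truncating the value \<open>\<infinity>\<close>
because a finite measure has an almost everywhere finite density.
\<close>

lemma density_enn2real_RN_deriv:
  assumes "sigma_finite_measure \<mu>" "sigma_finite_measure \<nu>" "absolutely_continuous \<mu> \<nu>" "sets \<nu> = sets \<mu>"
  shows "density \<mu> (\<lambda>x. ennreal (enn2real (RN_deriv \<mu> \<nu> x))) = \<nu>"
proof -
  interpret sigma_finite_measure \<mu> by fact
  have "AE x in \<mu>. ennreal (enn2real (RN_deriv \<mu> \<nu> x)) = RN_deriv \<mu> \<nu> x"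
    using RN_deriv_finite[OF assms(2-4)] by eventually_elim (auto simp: less_top)
  then have "density \<mu> (\<lambda>x. ennreal (enn2real (RN_deriv \<mu> \<nu> x))) = density \<mu> (RN_deriv \<mu> \<nu>)"
    by (intro density_cong) auto
  then show ?thesis using density_RN_deriv[OF assms(3,4)] by simp
qed

lemma bounded_integral_RN_deriv:
  fixes \<mu> \<nu> :: "'a measure" and g :: "'a \<Rightarrow> real"
  assumes "prob_space \<mu>" "prob_space \<nu>" "absolutely_continuous \<mu> \<nu>"
    and sets [measurable_cong]: "sets \<nu> = sets \<mu>"
    and [measurable]: "g \<in> borel_measurable \<mu>" and g: "\<And>x. \<bar>g x\<bar> \<le> K"
  shows "integrable \<mu> (\<lambda>x. enn2real (RN_deriv \<mu> \<nu> x) * g x)"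
    and "(\<integral>x. g x \<partial>\<nu>) = (\<integral>x. enn2real (RN_deriv \<mu> \<nu> x) * g x \<partial>\<mu>)"
proof -
  interpret M: prob_space \<mu> by fact
  interpret N: prob_space \<nu> by fact
  have dens: "\<nu> = density \<mu> (\<lambda>x. ennreal (enn2real (RN_deriv \<mu> \<nu> x)))"
    using density_enn2real_RN_deriv[OF M.sigma_finite_measure_axioms N.sigma_finite_measure_axioms]
      assms by simp
  have "integrable \<nu> g"
    by (rule N.integrable_const_bound[where B=K]) (use g in auto)
  then show "integrable \<mu> (\<lambda>x. enn2real (RN_deriv \<mu> \<nu> x) * g x)"
    by (subst (asm) dens, subst (asm) integrable_real_density) auto
  show "(\<integral>x. g x \<partial>\<nu>) = (\<integral>x. enn2real (RN_deriv \<mu> \<nu> x) * g x \<partial>\<mu>)"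
    by (subst dens, subst integral_real_density) auto
qed

text \<open>
Legendre duality between \<open>f log f - f\<close> and the exponential, on which the dual formula for the entropy
rests.
\<close>

lemma entropy_young:
  fixes f y :: real
  assumes "0 \<le> f" shows "f * y \<le> f * ln f - f + exp y"
proof (cases "f = 0")
  case False
  then have f: "f > 0" using assms by simp
  have "f * (1 + (y - ln f)) \<le> f * exp (y - ln f)"
    using f by (intro mult_left_mono exp_ge_add_one_self) auto
  also have "\<dots> = exp y" using f by (simp add: exp_diff)
  finally show ?thesis by (simp add: algebra_simps)
qed simp

text \<open>
Integrate \<open>entropy_young\<close> for the density \<open>f\<close> at \<open>y = \<phi> - log Z\<close>, where \<open>Z = \<integral>e\<^sup>\<phi> d\<mu>\<close> normalises \<open>e\<^sup>\<phi>\<close>.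
\<close>

lemma variational_bound_if_rel_entropy_le:
  fixes \<mu> \<nu> :: "'a measure"
  assumes "prob_space \<mu>" "prob_space \<nu>" and sets: "sets \<nu> = sets \<mu>"
    and H: "rel_entropy \<nu> \<mu> \<le> ereal c"
    and [measurable]: "\<phi> \<in> borel_measurable \<mu>" and bd: "\<And>x. \<bar>\<phi> x\<bar> \<le> k"
  shows "(\<integral>x. \<phi> x \<partial>\<nu>) \<le> c + ln (\<integral>x. exp (\<phi> x) \<partial>\<mu>)"
proof -
  interpret M: prob_space \<mu> by fact
  interpret N: prob_space \<nu> by fact
  define f where "f x = enn2real (RN_deriv \<mu> \<nu> x)" for x
  have ac: "absolutely_continuous \<mu> \<nu>" and int: "integrable \<mu> (\<lambda>x. f x * ln (f x))"
    and Hc: "(\<integral>x. f x * ln (f x) \<partial>\<mu>) \<le> c"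
    using H by (auto simp: rel_entropy_def f_def Let_def split: if_splits)
  have [measurable]: "f \<in> borel_measurable \<mu>" unfolding f_def by measurable
  have f0: "0 \<le> f x" for x by (simp add: f_def)
  have intf: "integrable \<mu> (\<lambda>x. f x * g x) \<and> (\<integral>x. g x \<partial>\<nu>) = (\<integral>x. f x * g x \<partial>\<mu>)"
    if "g \<in> borel_measurable \<mu>" "\<And>x. \<bar>g x\<bar> \<le> K" for g K
    unfolding f_def using bounded_integral_RN_deriv[OF assms(1,2) ac sets that] by simp
  have f1: "integrable \<mu> f" "(\<integral>x. f x \<partial>\<mu>) = 1"
    using intf[of "\<lambda>_. 1" 1] by (auto simp: N.prob_space)
  have f\<phi>: "integrable \<mu> (\<lambda>x. f x * \<phi> x)" "(\<integral>x. \<phi> x \<partial>\<nu>) = (\<integral>x. f x * \<phi> x \<partial>\<mu>)"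
    using intf[of \<phi> k] bd by auto
  have ie: "integrable \<mu> (\<lambda>x. exp (\<phi> x))"
    by (rule M.integrable_const_bound[where B="exp k"]) (use bd in \<open>auto simp: abs_le_iff\<close>)
  define Z where "Z = (\<integral>x. exp (\<phi> x) \<partial>\<mu>)"
  have "(\<integral>x. exp (- k) \<partial>\<mu>) \<le> Z" unfolding Z_def
    by (intro integral_mono ie) (use bd in \<open>auto simp: abs_le_iff minus_le_iff\<close>)
  then have Z: "Z > 0" using less_le_trans[OF exp_gt_zero[of "-k"]] by (simp add: M.prob_space)
  have "(\<integral>x. f x * \<phi> x - ln Z * f x \<partial>\<mu>) \<le> (\<integral>x. f x * ln (f x) - f x + exp (\<phi> x) / Z \<partial>\<mu>)"
  proof (rule integral_mono)
    fix x
    show "f x * \<phi> x - ln Z * f x \<le> f x * ln (f x) - f x + exp (\<phi> x) / Z"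
      using entropy_young[OF f0, of x "\<phi> x - ln Z"] Z by (simp add: exp_diff algebra_simps)
  qed (use f1 f\<phi> int ie in auto)
  also have "\<dots> = (\<integral>x. f x * ln (f x) \<partial>\<mu>) - 1 + Z / Z"
    using f1 int ie by (simp add: Z_def)
  also have "\<dots> \<le> c" using Hc Z by simp
  also have "(\<integral>x. f x * \<phi> x - ln Z * f x \<partial>\<mu>) = (\<integral>x. \<phi> x \<partial>\<nu>) - ln Z"
    using f1 f\<phi> by simp
  finally show ?thesis by (simp add: Z_def)
qed

text \<open>
Both sides pass to the limit by dominated convergence. This extends the inequality from Lipschitz
functions to indicators of closed sets and then to all bounded measurable functions.
\<close>

lemma variational_bound_limit:
  fixes \<mu> \<nu> :: "'a measure" and \<psi> :: "nat \<Rightarrow> 'a \<Rightarrow> real" and \<phi> :: "'a \<Rightarrow> real"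
  assumes "prob_space \<mu>" "prob_space \<nu>" and sets [measurable_cong]: "sets \<nu> = sets \<mu>"
    and meas [measurable]: "\<And>j. \<psi> j \<in> borel_measurable \<mu>" "\<phi> \<in> borel_measurable \<mu>"
    and bd: "\<And>j x. \<bar>\<psi> j x\<bar> \<le> k"
    and lim: "AE x in \<mu>. (\<lambda>j::nat. \<psi> j x) \<longlonglongrightarrow> \<phi> x" "AE x in \<nu>. (\<lambda>j. \<psi> j x) \<longlonglongrightarrow> \<phi> x"
    and le: "\<And>j. (\<integral>x. \<psi> j x \<partial>\<nu>) \<le> c + ln (\<integral>x. exp (\<psi> j x) \<partial>\<mu>)"
  shows "(\<integral>x. \<phi> x \<partial>\<nu>) \<le> c + ln (\<integral>x. exp (\<phi> x) \<partial>\<mu>)"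
proof -
  interpret M: prob_space \<mu> by fact
  interpret N: prob_space \<nu> by fact
  have "(\<lambda>j. \<integral>x. \<psi> j x \<partial>\<nu>) \<longlonglongrightarrow> (\<integral>x. \<phi> x \<partial>\<nu>)"
    by (rule integral_dominated_convergence[where w="\<lambda>_. k"]) (use lim bd in auto)
  moreover have E: "(\<lambda>j. \<integral>x. exp (\<psi> j x) \<partial>\<mu>) \<longlonglongrightarrow> (\<integral>x. exp (\<phi> x) \<partial>\<mu>)"
  proof (rule integral_dominated_convergence[where w="\<lambda>_. exp k"])
    show "AE x in \<mu>. (\<lambda>j. exp (\<psi> j x)) \<longlonglongrightarrow> exp (\<phi> x)"
      using lim(1) by eventually_elim (rule tendsto_exp)
    show "AE x in \<mu>. norm (exp (\<psi> j x)) \<le> exp k" for j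
      using bd[of j] by (intro AE_I2) (auto simp: abs_le_iff)
  qed auto
  moreover have "0 < (\<integral>x. exp (\<phi> x) \<partial>\<mu>)"
  proof -
    have "exp (- k) \<le> (\<integral>x. exp (\<psi> j x) \<partial>\<mu>)" for j
    proof -
      have "(\<integral>x. exp (- k) \<partial>\<mu>) \<le> (\<integral>x. exp (\<psi> j x) \<partial>\<mu>)"
      proof (rule integral_mono)
        show "integrable \<mu> (\<lambda>x. exp (\<psi> j x))"
          by (rule M.integrable_const_bound[where B="exp k"]) (use bd in \<open>auto simp: abs_le_iff\<close>)
        show "exp (- k) \<le> exp (\<psi> j x)" for x using bd[of j x] by (simp add: abs_le_iff)
      qed simp
      then show ?thesis by (simp add: M.prob_space)
    qed
    then have "exp (- k) \<le> (\<integral>x. exp (\<phi> x) \<partial>\<mu>)"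
      using E by (intro LIMSEQ_le_const) auto
    then show ?thesis using exp_gt_zero[of "- k"] by linarith
  qed
  ultimately show ?thesis using le
    by (intro LIMSEQ_le[of "\<lambda>j. \<integral>x. \<psi> j x \<partial>\<nu>" _ "\<lambda>j. c + ln (\<integral>x. exp (\<psi> j x) \<partial>\<mu>)"] tendsto_intros) auto
qed

text \<open>
The optimal \<open>\<phi>\<close> is the logarithm of the density \<open>f\<close>. As it is unbounded, it is clipped to \<open>[-j,j]\<close>, which
raises \<open>\<integral>e\<^sup>\<phi> d\<mu>\<close> to at most \<open>\<integral>f d\<mu> + exp(-j) = 1 + exp(-j)\<close>. The functions \<open>f \<phi>\<^sub>j\<close> are bounded below by \<open>-1\<close>, so
Fatou's lemma gives at once the integrability of \<open>f log f\<close> and the bound.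
\<close>

lemma rel_entropy_le_if_variational_bound:
  fixes \<mu> \<nu> :: "'a measure"
  assumes "prob_space \<mu>" "prob_space \<nu>" and sets [measurable_cong]: "sets \<nu> = sets \<mu>"
    and ac: "absolutely_continuous \<mu> \<nu>"
    and le: "\<And>(\<phi> :: 'a \<Rightarrow> real) k. \<phi> \<in> borel_measurable \<mu> \<Longrightarrow> (\<And>x. \<bar>\<phi> x\<bar> \<le> k)
       \<Longrightarrow> (\<integral>x. \<phi> x \<partial>\<nu>) \<le> c + ln (\<integral>x. exp (\<phi> x) \<partial>\<mu>)"
  shows "rel_entropy \<nu> \<mu> \<le> ereal c"
proof -
  interpret M: prob_space \<mu> by fact
  interpret N: prob_space \<nu> by fact
  define f where "f x = enn2real (RN_deriv \<mu> \<nu> x)" for x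
  have [measurable]: "f \<in> borel_measurable \<mu>" unfolding f_def by measurable
  have f0: "0 \<le> f x" for x by (simp add: f_def)
  have intf: "integrable \<mu> (\<lambda>x. f x * g x) \<and> (\<integral>x. g x \<partial>\<nu>) = (\<integral>x. f x * g x \<partial>\<mu>)"
    if "g \<in> borel_measurable \<mu>" "\<And>x. \<bar>g x\<bar> \<le> K" for g K
    unfolding f_def using bounded_integral_RN_deriv[OF assms(1,2) ac sets that] by simp
  have f1: "integrable \<mu> f" "(\<integral>x. f x \<partial>\<mu>) = 1"
    using intf[of "\<lambda>_. 1" 1] by (auto simp: N.prob_space)
  define \<phi> where "\<phi> j x = (if f x = 0 then - real j else max (- real j) (min (real j) (ln (f x))))"
    for j :: nat and x
  have [measurable]: "\<phi> j \<in> borel_measurable \<mu>" for j unfolding \<phi>_def by measurable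
  have \<phi>bd: "\<bar>\<phi> j x\<bar> \<le> real j" for j x by (auto simp: \<phi>_def)
  have exp\<phi>: "exp (\<phi> j x) \<le> f x + exp (- real j)" for j x
  proof (cases "f x = 0")
    case False
    then have "f x > 0" using f0[of x] by simp
    have "\<phi> j x \<le> max (- real j) (ln (f x))" using False by (auto simp: \<phi>_def)
    then have "exp (\<phi> j x) \<le> exp (max (- real j) (ln (f x)))" by simp
    also have "\<dots> \<le> f x + exp (- real j)" using \<open>f x > 0\<close> by (simp add: max_def)
    finally show ?thesis .
  qed (simp add: \<phi>_def)
  have bound: "(\<integral>x. f x * \<phi> j x \<partial>\<mu>) \<le> c + exp (- real j)" for j
  proof -
    have ie: "integrable \<mu> (\<lambda>x. exp (\<phi> j x))"
      by (rule M.integrable_const_bound[where B="exp (real j)"]) (use \<phi>bd in \<open>auto simp: abs_le_iff\<close>)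
    have "(\<integral>x. exp (- real j) \<partial>\<mu>) \<le> (\<integral>x. exp (\<phi> j x) \<partial>\<mu>)"
      using \<phi>bd by (intro integral_mono ie) (auto simp: abs_le_iff minus_le_iff)
    then have pos: "0 < (\<integral>x. exp (\<phi> j x) \<partial>\<mu>)"
      using less_le_trans[OF exp_gt_zero[of "- real j"]] by (simp add: M.prob_space)
    have "(\<integral>x. exp (\<phi> j x) \<partial>\<mu>) \<le> (\<integral>x. f x + exp (- real j) \<partial>\<mu>)"
      using exp\<phi> f1 by (intro integral_mono ie) auto
    also have "\<dots> = 1 + exp (- real j)" using f1 by (simp add: M.prob_space)
    finally have "ln (\<integral>x. exp (\<phi> j x) \<partial>\<mu>) \<le> ln (1 + exp (- real j))" using pos by simp
    also have "\<dots> \<le> exp (- real j)" by (rule ln_add_one_self_le_self) simp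
    finally show ?thesis using le[of "\<phi> j" "real j"] \<phi>bd[of j] intf[of "\<phi> j" "real j"] by simp
  qed
  \<comment> \<open>Clipping from below only raises the negative values of \<open>f log f\<close>, which are at least \<open>f - 1\<close>.\<close>
  have below: "-1 \<le> f x * \<phi> j x" for j x
  proof (cases "f x = 0 \<or> 0 \<le> \<phi> j x")
    case True
    then have "0 \<le> f x * \<phi> j x" using f0[of x] by auto
    then show ?thesis by simp
  next
    case False
    then have f: "f x > 0" using f0[of x] by simp
    have "ln (f x) \<le> \<phi> j x" using False f by (auto simp: \<phi>_def split: if_splits)
    then have "f x * ln (f x) \<le> f x * \<phi> j x" using f by simp
    moreover have "f x - 1 \<le> f x * ln (f x)" using entropy_young[OF f0, of x 0] by simp
    ultimately show ?thesis using f by linarith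
  qed
  have below': "0 \<le> f x * \<phi> j x + 1" for j x using below[of x j] by linarith
  have lim: "(\<lambda>j. f x * \<phi> j x) \<longlonglongrightarrow> f x * ln (f x)" for x
  proof (cases "f x = 0")
    case False
    have "\<forall>\<^sub>F j in sequentially. \<bar>ln (f x)\<bar> \<le> real j"
      using filterlim_real_sequentially unfolding filterlim_at_top by blast
    then have "\<forall>\<^sub>F j in sequentially. f x * \<phi> j x = f x * ln (f x)"
      by eventually_elim (use False in \<open>auto simp: \<phi>_def\<close>)
    then show ?thesis by (rule tendsto_eventually)
  qed simp
  have c0: "0 \<le> c" using le[of "\<lambda>_. 0" 0] by (simp add: M.prob_space)
  have "(\<integral>\<^sup>+x. ennreal (f x * ln (f x) + 1) \<partial>\<mu>) = (\<integral>\<^sup>+x. liminf (\<lambda>j. ennreal (f x * \<phi> j x + 1)) \<partial>\<mu>)"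
  proof (rule nn_integral_cong)
    fix x
    have "(\<lambda>j. ennreal (f x * \<phi> j x + 1)) \<longlonglongrightarrow> ennreal (f x * ln (f x) + 1)"
      by (intro tendsto_ennrealI tendsto_add lim tendsto_const)
    then show "ennreal (f x * ln (f x) + 1) = liminf (\<lambda>j. ennreal (f x * \<phi> j x + 1))"
      by (intro lim_imp_Liminf[symmetric]) auto
  qed
  also have "\<dots> \<le> liminf (\<lambda>j. \<integral>\<^sup>+x. ennreal (f x * \<phi> j x + 1) \<partial>\<mu>)"
    by (rule nn_integral_liminf) measurable
  also have "\<dots> \<le> liminf (\<lambda>j. ennreal (c + exp (- real j) + 1))"
  proof (rule Liminf_mono, rule always_eventually, rule allI)
    fix j
    have "(\<integral>\<^sup>+x. ennreal (f x * \<phi> j x + 1) \<partial>\<mu>) = ennreal (\<integral>x. f x * \<phi> j x + 1 \<partial>\<mu>)"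
      using intf[of "\<phi> j" "real j"] \<phi>bd[of j] below'[of _ j]
      by (intro nn_integral_eq_integral) auto
    also have "(\<integral>x. f x * \<phi> j x + 1 \<partial>\<mu>) \<le> c + exp (- real j) + 1"
      using bound[of j] intf[of "\<phi> j" "real j"] \<phi>bd[of j] by (simp add: M.prob_space)
    finally show "(\<integral>\<^sup>+x. ennreal (f x * \<phi> j x + 1) \<partial>\<mu>) \<le> ennreal (c + exp (- real j) + 1)"
      by (simp add: ennreal_leI)
  qed
  also have "\<dots> = ennreal (c + 0 + 1)"
  proof (rule lim_imp_Liminf)
    have "filterlim (\<lambda>j. - real j) at_bot sequentially"
      using filterlim_real_sequentially by (simp add: filterlim_uminus_at_bot)
    then have "(\<lambda>j. exp (- real j)) \<longlonglongrightarrow> 0" by (rule filterlim_compose[OF exp_at_bot])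
    then show "(\<lambda>j. ennreal (c + exp (- real j) + 1)) \<longlonglongrightarrow> ennreal (c + 0 + 1)"
      by (intro tendsto_ennrealI tendsto_intros)
  qed simp
  finally have nn: "(\<integral>\<^sup>+x. ennreal (f x * ln (f x) + 1) \<partial>\<mu>) \<le> ennreal (c + 1)" by simp
  have pos: "0 \<le> f x * ln (f x) + 1" for x
    using entropy_young[OF f0, of x 0] f0[of x] by simp
  have int1: "integrable \<mu> (\<lambda>x. f x * ln (f x) + 1)"
    by (rule integrableI_bounded) (use nn pos in \<open>auto simp: le_less_trans\<close>)
  then have int: "integrable \<mu> (\<lambda>x. f x * ln (f x))"
    using Bochner_Integration.integrable_diff[OF int1, of "\<lambda>_. 1"] by simp
  have "ennreal (\<integral>x. f x * ln (f x) + 1 \<partial>\<mu>) \<le> ennreal (c + 1)"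
    using nn pos by (subst (asm) nn_integral_eq_integral[OF int1]) auto
  then have "(\<integral>x. f x * ln (f x) + 1 \<partial>\<mu>) \<le> c + 1"
    by (subst (asm) ennreal_le_iff) (use c0 in auto)
  then have "(\<integral>x. f x * ln (f x) \<partial>\<mu>) \<le> c" using int by (simp add: M.prob_space)
  then show ?thesis using ac int by (simp add: rel_entropy_def Let_def flip: f_def)
qed

text \<open>
Bounded Lipschitz functions suffice. Large multiples of approximations of the indicator of a closed
\<open>\<mu>\<close>-null set show that \<open>\<nu>\<close> does not charge it, so \<open>\<nu>\<close> is absolutely continuous by inner regularity. An
approximation of a bounded function in \<open>L\<^sup>1(\<mu>)\<close> then has a subsequence that converges almost everywhere
for \<open>\<nu>\<close> as well.
\<close>

theorem rel_entropy_le_if_lipschitz_variational_bound: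
  fixes \<mu> \<nu> :: "'a::euclidean_space measure"
  assumes pM: "prob_space \<mu>" and pN: "prob_space \<nu>"
    and sM [measurable_cong]: "sets \<mu> = sets borel" and sN [measurable_cong]: "sets \<nu> = sets borel"
    and le: "\<And>(\<phi> :: 'a \<Rightarrow> real) k L. L-lipschitz_on UNIV \<phi> \<Longrightarrow> (\<And>x. \<bar>\<phi> x\<bar> \<le> k)
       \<Longrightarrow> (\<integral>x. \<phi> x \<partial>\<nu>) \<le> c + ln (\<integral>x. exp (\<phi> x) \<partial>\<mu>)"
  shows "rel_entropy \<nu> \<mu> \<le> ereal c"
proof -
  interpret M: prob_space \<mu> by fact
  interpret N: prob_space \<nu> by fact
  have closed_null: "measure \<nu> F = 0" if F: "closed F" "measure \<mu> F = 0" for F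
  proof (rule ccontr)
    assume "measure \<nu> F \<noteq> 0"
    then have pos: "measure \<nu> F > 0" by (simp add: zero_less_measure_iff)
    \<comment> \<open>The factor is chosen such that \<open>a \<nu>(F)\<close> exceeds \<open>c\<close>.\<close>
    define a where "a = (\<bar>c\<bar> + 1) / measure \<nu> F"
    have a: "a > 0" using pos by (simp add: a_def)
    obtain \<psi> :: "nat \<Rightarrow> 'a \<Rightarrow> real" where \<psi>: "\<And>j. (real j)-lipschitz_on UNIV (\<psi> j)"
        "\<And>j x. 0 \<le> \<psi> j x" "\<And>j x. \<psi> j x \<le> 1"
        "\<And>x. (\<lambda>j. \<psi> j x) \<longlonglongrightarrow> indicator F x"
      using closed_indicator_lipschitz_limit[OF F(1)] by blast
    have [measurable]: "F \<in> sets borel" using F by simp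
    have [measurable]: "\<psi> j \<in> borel_measurable borel" for j
      by (rule borel_measurable_lipschitz[OF \<psi>(1)])
    have bd: "\<bar>a * \<psi> j x\<bar> \<le> a" for j x
      using \<psi>(2,3)[of j x] a by (simp add: abs_mult)
    have "(\<integral>x. a * indicator F x \<partial>\<nu>) \<le> c + ln (\<integral>x. exp (a * indicator F x) \<partial>\<mu>)"
    proof (rule variational_bound_limit[OF pM pN, where \<psi>="\<lambda>j x. a * \<psi> j x" and k=a])
      show "(\<integral>x. a * \<psi> j x \<partial>\<nu>) \<le> c + ln (\<integral>x. exp (a * \<psi> j x) \<partial>\<mu>)" for j
        by (rule le[OF lipschitz_on_cmult_real[OF \<psi>(1)] bd])
    qed (auto simp: sM sN bd intro!: tendsto_intros \<psi>)
    moreover have "(\<integral>x. exp (a * indicator F x) \<partial>\<mu>) = (\<integral>x. 1 \<partial>\<mu>)"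
    proof (rule integral_cong_AE)
      have "AE x in \<mu>. x \<notin> F"
        using F by (intro AE_not_in) (auto simp: null_sets_def M.emeasure_eq_measure sM)
      then show "AE x in \<mu>. exp (a * indicator F x) = 1" by eventually_elim simp
    qed auto
    moreover have "(\<integral>x. a * indicator F x \<partial>\<nu>) = a * measure \<nu> F" using sN by simp
    moreover have "a * measure \<nu> F = \<bar>c\<bar> + 1" using pos by (simp add: a_def)
    ultimately show False by (simp add: M.prob_space)
  qed
  have ac: "absolutely_continuous \<mu> \<nu>"
    unfolding absolutely_continuous_def
  proof
    fix A assume A: "A \<in> null_sets \<mu>"
    then have [measurable]: "A \<in> sets borel" using sM by auto
    have "emeasure \<nu> A = (SUP K \<in> {K. K \<subseteq> A \<and> compact K}. emeasure \<nu> K)"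
      by (rule inner_regular) (use sN in auto)
    also have "\<dots> \<le> 0"
    proof (rule SUP_least)
      fix K assume K: "K \<in> {K. K \<subseteq> A \<and> compact K}"
      then have "closed K" by (simp add: compact_imp_closed)
      moreover have "emeasure \<mu> K \<le> emeasure \<mu> A" using K by (intro emeasure_mono) (auto simp: sM)
      then have "measure \<mu> K = 0" using A by (simp add: null_sets_def measure_def)
      ultimately have "measure \<nu> K = 0" by (rule closed_null)
      then show "emeasure \<nu> K \<le> 0" by (simp add: N.emeasure_eq_measure)
    qed
    finally show "A \<in> null_sets \<nu>" by (simp add: null_sets_def sN)
  qed
  show ?thesis
  proof (rule rel_entropy_le_if_variational_bound[OF pM pN _ ac])
    show "sets \<nu> = sets \<mu>" by (simp add: sM sN)
    fix \<phi> :: "'a \<Rightarrow> real" and k assume meas: "\<phi> \<in> borel_measurable \<mu>" and bd: "\<And>x. \<bar>\<phi> x\<bar> \<le> k"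
    have [measurable]: "\<phi> \<in> borel_measurable borel" using meas by (simp cong: measurable_cong_sets add: sM)
    have int: "integrable \<mu> \<phi>" by (rule M.integrable_const_bound[where B=k]) (use bd in auto)
    have "\<exists>\<psi> L. L-lipschitz_on UNIV \<psi> \<and> integrable \<mu> \<psi> \<and> (\<integral>x. \<bar>\<phi> x - \<psi> x\<bar> \<partial>\<mu>) < 1 / Suc j" for j
      by (rule lipschitz_dense_L1[OF M.finite_measure_axioms sM int]) simp
    then obtain \<psi>0 L where \<psi>0: "\<And>j. (L j)-lipschitz_on UNIV (\<psi>0 j)" "\<And>j. integrable \<mu> (\<psi>0 j)"
        "\<And>j. (\<integral>x. \<bar>\<phi> x - \<psi>0 j x\<bar> \<partial>\<mu>) < 1 / Suc j" by metis
    define \<psi> where "\<psi> j x = max (- k) (min k (\<psi>0 j x))" for j x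
    have k: "0 \<le> k" using bd[of undefined] by linarith
    have lip: "(L j)-lipschitz_on UNIV (\<psi> j)" for j
      unfolding \<psi>_def by (rule lipschitz_on_clip[OF \<psi>0(1)])
    have \<psi>bd: "\<bar>\<psi> j x\<bar> \<le> k" for j x using k by (auto simp: \<psi>_def)
    have [measurable]: "\<psi> j \<in> borel_measurable borel" for j by (rule borel_measurable_lipschitz[OF lip])
    have int\<psi>: "integrable \<mu> (\<psi> j)" for j
      by (rule M.integrable_const_bound[where B=k]) (use \<psi>bd in auto)
    have small: "(\<integral>x. \<bar>\<phi> x - \<psi> j x\<bar> \<partial>\<mu>) \<le> 1 / Suc j" for j
    proof -
      have "(\<integral>x. \<bar>\<phi> x - \<psi> j x\<bar> \<partial>\<mu>) \<le> (\<integral>x. \<bar>\<phi> x - \<psi>0 j x\<bar> \<partial>\<mu>)"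
      proof (rule integral_mono)
        fix x show "\<bar>\<phi> x - \<psi> j x\<bar> \<le> \<bar>\<phi> x - \<psi>0 j x\<bar>"
          using bd[of x] by (auto simp: \<psi>_def abs_le_iff)
      qed (use int int\<psi> \<psi>0(2) in auto)
      then show ?thesis using \<psi>0(3)[of j] by simp
    qed
    have "(\<lambda>j. \<integral>x. norm (\<phi> x - \<psi> j x) \<partial>\<mu>) \<longlonglongrightarrow> 0"
    proof (rule tendsto_sandwich[of "\<lambda>_. 0" _ _ "\<lambda>j. 1 / real (Suc j)"])
      show "(\<lambda>j. 1 / real (Suc j)) \<longlonglongrightarrow> 0" using LIMSEQ_inverse_real_of_nat by (simp add: inverse_eq_divide)
    qed (use small in auto)
    then obtain r where r: "strict_mono r" "AE x in \<mu>. (\<lambda>n. \<phi> x - \<psi> (r n) x) \<longlonglongrightarrow> 0"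
      using tendsto_L1_AE_subseq[of \<mu> "\<lambda>j x. \<phi> x - \<psi> j x"] int int\<psi> by auto
    have lim: "AE x in \<mu>. (\<lambda>n. \<psi> (r n) x) \<longlonglongrightarrow> \<phi> x"
      using r(2)
    proof eventually_elim
      case (elim x)
      from tendsto_diff[OF tendsto_const elim, of "\<phi> x"] show ?case by simp
    qed
    show "(\<integral>x. \<phi> x \<partial>\<nu>) \<le> c + ln (\<integral>x. exp (\<phi> x) \<partial>\<mu>)"
    proof (rule variational_bound_limit[OF pM pN, where \<psi>="\<lambda>n. \<psi> (r n)" and k=k])
      show "AE x in \<nu>. (\<lambda>n. \<psi> (r n) x) \<longlonglongrightarrow> \<phi> x"
        using lim by (rule absolutely_continuous_AE[OF _ ac, rotated]) (simp add: sM sN)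
    qed (use lim lip \<psi>bd in \<open>auto simp: sM sN intro: le\<close>)
  qed
qed

section \<open>The Wasserstein distance\<close>

lemma L2_cauchy_schwarz_minkowski:
  fixes f g :: "'a \<Rightarrow> real"
  assumes [measurable]: "f \<in> borel_measurable M" "g \<in> borel_measurable M"
    and f0: "\<And>x. 0 \<le> f x" and g0: "\<And>x. 0 \<le> g x"
    and f2: "integrable M (\<lambda>x. (f x)\<^sup>2)" and g2: "integrable M (\<lambda>x. (g x)\<^sup>2)"
  shows "(\<integral>x. f x * g x \<partial>M) \<le> sqrt (\<integral>x. (f x)\<^sup>2 \<partial>M) * sqrt (\<integral>x. (g x)\<^sup>2 \<partial>M)"
    and "sqrt (\<integral>x. (f x + g x)\<^sup>2 \<partial>M) \<le> sqrt (\<integral>x. (f x)\<^sup>2 \<partial>M) + sqrt (\<integral>x. (g x)\<^sup>2 \<partial>M)"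
    and "integrable M (\<lambda>x. (f x + g x)\<^sup>2)" and "integrable M (\<lambda>x. f x * g x)"
proof -
  show fg: "integrable M (\<lambda>x. f x * g x)"
  proof (rule Bochner_Integration.integrable_bound[of _ "\<lambda>x. (f x)\<^sup>2 + (g x)\<^sup>2"])
    show "AE x in M. norm (f x * g x) \<le> norm ((f x)\<^sup>2 + (g x)\<^sup>2)"
    proof (rule AE_I2)
      fix x
      have "2 * f x * g x \<le> (f x)\<^sup>2 + (g x)\<^sup>2" by (rule sum_squares_bound)
      moreover have "0 \<le> f x * g x" using f0 g0 by simp
      ultimately show "norm (f x * g x) \<le> norm ((f x)\<^sup>2 + (g x)\<^sup>2)" by simp
    qed
  qed (use f2 g2 in auto)
  have "(\<integral>\<^sup>+x. ennreal (f x) * ennreal (g x) \<partial>M)\<^sup>2 \<le> (\<integral>\<^sup>+x. ennreal (f x) ^ 2 \<partial>M) * (\<integral>\<^sup>+x. ennreal (g x) ^ 2 \<partial>M)"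
    by (rule Cauchy_Schwarz_nn_integral) measurable
  also have "(\<integral>\<^sup>+x. ennreal (f x) * ennreal (g x) \<partial>M) = ennreal (\<integral>x. f x * g x \<partial>M)"
    using fg f0 g0 by (subst nn_integral_eq_integral[symmetric]) (auto simp: ennreal_mult)
  also have "(\<integral>\<^sup>+x. ennreal (f x) ^ 2 \<partial>M) = ennreal (\<integral>x. (f x)\<^sup>2 \<partial>M)"
    using f2 f0 by (subst nn_integral_eq_integral[symmetric]) (auto simp: ennreal_power)
  also have "(\<integral>\<^sup>+x. ennreal (g x) ^ 2 \<partial>M) = ennreal (\<integral>x. (g x)\<^sup>2 \<partial>M)"
    using g2 g0 by (subst nn_integral_eq_integral[symmetric]) (auto simp: ennreal_power)
  finally have "(\<integral>x. f x * g x \<partial>M)\<^sup>2 \<le> (\<integral>x. (f x)\<^sup>2 \<partial>M) * (\<integral>x. (g x)\<^sup>2 \<partial>M)"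
    using f0 g0 by (simp add: ennreal_power ennreal_le_iff flip: ennreal_mult)
  then have "sqrt ((\<integral>x. f x * g x \<partial>M)\<^sup>2) \<le> sqrt ((\<integral>x. (f x)\<^sup>2 \<partial>M) * (\<integral>x. (g x)\<^sup>2 \<partial>M))"
    by (rule real_sqrt_le_mono)
  then show CS: "(\<integral>x. f x * g x \<partial>M) \<le> sqrt (\<integral>x. (f x)\<^sup>2 \<partial>M) * sqrt (\<integral>x. (g x)\<^sup>2 \<partial>M)"
    by (simp add: real_sqrt_mult)
  have eq: "(f x + g x)\<^sup>2 = (f x)\<^sup>2 + 2 * (f x * g x) + (g x)\<^sup>2" for x by (simp add: power2_sum)
  show "integrable M (\<lambda>x. (f x + g x)\<^sup>2)"
    unfolding eq using f2 g2 fg by auto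
  have "(\<integral>x. (f x + g x)\<^sup>2 \<partial>M) = (\<integral>x. (f x)\<^sup>2 \<partial>M) + 2 * (\<integral>x. f x * g x \<partial>M) + (\<integral>x. (g x)\<^sup>2 \<partial>M)"
    unfolding eq using f2 g2 fg by simp
  also have "\<dots> \<le> (\<integral>x. (f x)\<^sup>2 \<partial>M) + 2 * (sqrt (\<integral>x. (f x)\<^sup>2 \<partial>M) * sqrt (\<integral>x. (g x)\<^sup>2 \<partial>M)) + (\<integral>x. (g x)\<^sup>2 \<partial>M)"
    using CS by simp
  also have "\<dots> = (sqrt (\<integral>x. (f x)\<^sup>2 \<partial>M) + sqrt (\<integral>x. (g x)\<^sup>2 \<partial>M))\<^sup>2"
    by (simp add: power2_sum)
  finally show "sqrt (\<integral>x. (f x + g x)\<^sup>2 \<partial>M) \<le> sqrt (\<integral>x. (f x)\<^sup>2 \<partial>M) + sqrt (\<integral>x. (g x)\<^sup>2 \<partial>M)"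
    by (rule real_le_lsqrt[rotated -1]) simp_all
qed

lemma couplingD:
  assumes \<pi>: "\<pi> \<in> couplings \<mu> \<nu>" and "\<mu> \<in> P2" "\<nu> \<in> P2"
  shows "prob_space \<pi>" "sets \<pi> = sets (borel \<Otimes>\<^sub>M borel)"
    "distr \<pi> borel fst = \<mu>" "distr \<pi> borel snd = \<nu>"
    "integrable \<pi> (\<lambda>(x, y). (norm (y - x))\<^sup>2)"
proof -
  show s [measurable_cong]: "sets \<pi> = sets (borel \<Otimes>\<^sub>M borel)"
    and d1: "distr \<pi> borel fst = \<mu>" and d2: "distr \<pi> borel snd = \<nu>"
    using \<pi> by (auto simp: couplings_def)
  have "prob_space (distr \<pi> borel fst)" using d1 assms by (simp add: P2_def)
  then show "prob_space \<pi>" by (rule prob_space_distrD[rotated]) measurable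
  have "integrable (distr \<pi> borel fst) (\<lambda>x. (norm x)\<^sup>2)" "integrable (distr \<pi> borel snd) (\<lambda>x. (norm x)\<^sup>2)"
    unfolding d1 d2 using assms by (auto simp: P2_def)
  then have "integrable \<pi> (\<lambda>z. (norm (fst z))\<^sup>2)" "integrable \<pi> (\<lambda>z. (norm (snd z))\<^sup>2)"
    by (auto simp: integrable_distr_eq)
  then have "integrable \<pi> (\<lambda>z. 2 * (norm (fst z))\<^sup>2 + 2 * (norm (snd z))\<^sup>2)" by simp
  then show "integrable \<pi> (\<lambda>(x, y). (norm (y - x))\<^sup>2)"
  proof (rule Bochner_Integration.integrable_bound)
    show "AE z in \<pi>. norm (case z of (x, y) \<Rightarrow> (norm (y - x))\<^sup>2)
        \<le> norm (2 * (norm (fst z))\<^sup>2 + 2 * (norm (snd z))\<^sup>2)"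
    proof (rule AE_I2, clarify)
      fix x y :: 'a
      have "(norm (y - x))\<^sup>2 \<le> (norm y + norm x)\<^sup>2" by (intro power_mono norm_triangle_ineq4) auto
      also have "\<dots> \<le> 2 * (norm x)\<^sup>2 + 2 * (norm y)\<^sup>2"
        using sum_squares_bound[of "norm x" "norm y"] by (simp add: power2_sum algebra_simps)
      finally show "norm ((norm (y - x))\<^sup>2) \<le> norm (2 * (norm (fst (x, y)))\<^sup>2 + 2 * (norm (snd (x, y)))\<^sup>2)"
        by simp
    qed
  qed measurable
qed

lemma product_coupling:
  assumes "\<mu> \<in> P2" "\<nu> \<in> P2"
  shows "\<mu> \<Otimes>\<^sub>M \<nu> \<in> couplings \<mu> \<nu>"
proof -
  interpret \<mu>: prob_space \<mu> using assms by (simp add: P2_def)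
  interpret \<nu>: prob_space \<nu> using assms by (simp add: P2_def)
  interpret pair_prob_space \<mu> \<nu> ..
  have s: "sets \<mu> = sets borel" "sets \<nu> = sets borel" using assms by (auto simp: P2_def)
  have "distr (\<mu> \<Otimes>\<^sub>M \<nu>) borel fst = distr (\<mu> \<Otimes>\<^sub>M \<nu>) \<mu> fst"
    by (rule distr_cong) (auto simp: s)
  moreover have "distr (\<mu> \<Otimes>\<^sub>M \<nu>) borel snd = distr (\<mu> \<Otimes>\<^sub>M \<nu>) \<nu> snd"
    by (rule distr_cong) (auto simp: s)
  moreover have "distr (\<mu> \<Otimes>\<^sub>M \<nu>) \<mu> fst = \<mu>" by (rule \<nu>.distr_pair_fst)
  moreover have "distr (\<mu> \<Otimes>\<^sub>M \<nu>) \<nu> snd = \<nu>"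
  proof -
    have "distr (\<mu> \<Otimes>\<^sub>M \<nu>) \<nu> snd = distr (distr (\<nu> \<Otimes>\<^sub>M \<mu>) (\<mu> \<Otimes>\<^sub>M \<nu>) (\<lambda>(x, y). (y, x))) \<nu> snd"
      using distr_pair_swap by simp
    also have "\<dots> = distr (\<nu> \<Otimes>\<^sub>M \<mu>) \<nu> fst"
      by (subst distr_distr) (auto simp: o_def split_def)
    also have "\<dots> = \<nu>" by (rule \<mu>.distr_pair_fst)
    finally show ?thesis .
  qed
  ultimately show ?thesis
    by (auto simp: couplings_def intro!: sets_pair_measure_cong s)
qed

lemma transport_cost_nonneg: "0 \<le> (\<integral>(x, y). (norm (y - x))\<^sup>2 \<partial>\<pi>)"
  by (rule Bochner_Integration.integral_nonneg) (simp add: split_beta)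

lemma W2_bdd: "bdd_below ((\<lambda>\<pi>. sqrt (\<integral>(x, y). (norm (y - x))\<^sup>2 \<partial>\<pi>)) ` couplings \<mu> \<nu>)"
  by (rule bdd_belowI[of _ 0]) (auto intro!: transport_cost_nonneg)

lemma W2_le: "\<pi> \<in> couplings \<mu> \<nu> \<Longrightarrow> W2 \<mu> \<nu> \<le> sqrt (\<integral>(x, y). (norm (y - x))\<^sup>2 \<partial>\<pi>)"
  unfolding W2_def by (rule cINF_lower[OF W2_bdd])

lemma W2_greatest:
  assumes "\<mu> \<in> P2" "\<nu> \<in> P2"
    and "\<And>\<pi>. \<pi> \<in> couplings \<mu> \<nu> \<Longrightarrow> a \<le> sqrt (\<integral>(x, y). (norm (y - x))\<^sup>2 \<partial>\<pi>)"
  shows "a \<le> W2 \<mu> \<nu>"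
  unfolding W2_def using product_coupling[OF assms(1,2)] assms(3) by (intro cINF_greatest) auto

lemma W2_nonneg: "\<mu> \<in> P2 \<Longrightarrow> \<nu> \<in> P2 \<Longrightarrow> 0 \<le> W2 \<mu> \<nu>"
  by (rule W2_greatest) (auto intro!: transport_cost_nonneg)

lemma W2_refl:
  assumes "\<mu> \<in> P2" shows "W2 \<mu> \<mu> = 0"
proof -
  have s [measurable_cong]: "sets \<mu> = sets borel" using assms by (auto simp: P2_def)
  let ?\<pi> = "distr \<mu> (borel \<Otimes>\<^sub>M borel) (\<lambda>x. (x, x))"
  have id: "distr \<mu> borel (\<lambda>x. x) = \<mu>" by (rule distr_id2) (simp add: s)
  have "?\<pi> \<in> couplings \<mu> \<mu>"
    by (auto simp: couplings_def distr_distr o_def id)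
  then have "W2 \<mu> \<mu> \<le> 0" using W2_le[of ?\<pi> \<mu> \<mu>] by (simp add: integral_distr)
  then show ?thesis using W2_nonneg[OF assms assms] by simp
qed

lemma W2_commute_le:
  assumes "\<mu> \<in> P2" "\<nu> \<in> P2" shows "W2 \<nu> \<mu> \<le> W2 \<mu> \<nu>"
proof (rule W2_greatest[OF assms])
  fix \<pi> assume \<pi>: "\<pi> \<in> couplings \<mu> \<nu>"
  then have s [measurable_cong]: "sets \<pi> = sets (borel \<Otimes>\<^sub>M borel)" by (auto simp: couplings_def)
  let ?\<pi> = "distr \<pi> (borel \<Otimes>\<^sub>M borel) (\<lambda>z. (snd z, fst z))"
  have "?\<pi> \<in> couplings \<nu> \<mu>"
    using \<pi> by (auto simp: couplings_def distr_distr o_def)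
  then have "W2 \<nu> \<mu> \<le> sqrt (\<integral>(x, y). (norm (y - x))\<^sup>2 \<partial>?\<pi>)" by (rule W2_le)
  also have "\<dots> = sqrt (\<integral>(x, y). (norm (y - x))\<^sup>2 \<partial>\<pi>)"
    by (simp add: integral_distr split_def norm_minus_commute)
  finally show "W2 \<nu> \<mu> \<le> sqrt (\<integral>(x, y). (norm (y - x))\<^sup>2 \<partial>\<pi>)" .
qed

lemma W2_commute: "\<mu> \<in> P2 \<Longrightarrow> \<nu> \<in> P2 \<Longrightarrow> W2 \<mu> \<nu> = W2 \<nu> \<mu>"
  by (intro antisym W2_commute_le)

text \<open>
The cells are the level sets of \<open>q\<close>, the first index of a dense sequence at which a point is
approximated up to \<open>\<delta>/2\<close>.
\<close>

lemma countable_borel_cells: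
  assumes "\<delta> > 0"
  obtains q :: "'a::euclidean_space \<Rightarrow> nat" where "q \<in> borel \<rightarrow>\<^sub>M count_space UNIV"
    "\<And>x y. q x = q y \<Longrightarrow> dist x y \<le> \<delta>"
proof -
  obtain D :: "'a set" where D: "countable D" "\<And>X. open X \<Longrightarrow> X \<noteq> {} \<Longrightarrow> \<exists>d \<in> D. d \<in> X"
    by (rule countable_dense_setE) blast
  define a where "a = from_nat_into D"
  have "D \<noteq> {}" using D(2)[of UNIV] by auto
  then have a: "range a = D" unfolding a_def using D(1) by (rule range_from_nat_into)
  define q where "q x = (LEAST i. dist x (a i) < \<delta>/2)" for x
  have q: "dist x (a (q x)) < \<delta>/2" for x
  proof -
    obtain d where "d \<in> D" "d \<in> ball x (\<delta>/2)" using D(2)[of "ball x (\<delta>/2)"] assms by auto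
    then obtain i where "dist x (a i) < \<delta>/2" using a by auto
    then show ?thesis unfolding q_def by (rule LeastI)
  qed
  show ?thesis
  proof (rule that[of q])
    show "q \<in> borel \<rightarrow>\<^sub>M count_space UNIV" unfolding q_def by measurable
    fix x y assume "q x = q y"
    then show "dist x y \<le> \<delta>"
      using q[of x] q[of y] dist_triangle2[of x y "a (q x)"] by simp
  qed
qed

text \<open>
Two couplings that share the marginal \<open>\<mu>\<close> are glued up to an error \<open>\<delta>\<close>: choose their points independently
given that the \<open>\<mu>\<close>-components fall in the same cell. The density \<open>w\<close> of this law with respect to the
product integrates to \<open>1\<close> in each variable, which preserves the two couplings as marginals. With
countably many cells this conditioning is elementary.
\<close>

lemma approximate_gluing:
  fixes \<mu> :: "'a::euclidean_space measure"
  assumes pr: "prob_space \<pi>" "prob_space \<pi>'" and "\<delta> > 0"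
    and g [measurable]: "g \<in> \<pi> \<rightarrow>\<^sub>M borel" and h [measurable]: "h \<in> \<pi>' \<rightarrow>\<^sub>M borel"
    and eq: "distr \<pi> borel g = \<mu>" "distr \<pi>' borel h = \<mu>"
  obtains \<Gamma> where "sets \<Gamma> = sets (\<pi> \<Otimes>\<^sub>M \<pi>')" "distr \<Gamma> \<pi> fst = \<pi>" "distr \<Gamma> \<pi>' snd = \<pi>'"
    "AE z in \<Gamma>. dist (g (fst z)) (h (snd z)) \<le> \<delta>"
proof -
  interpret A: prob_space \<pi> by fact
  interpret B: prob_space \<pi>' by fact
  interpret pair_prob_space \<pi> \<pi>' ..
  interpret M: prob_space \<mu> unfolding eq(1)[symmetric] by (rule A.prob_space_distr) measurable
  have s [measurable_cong]: "sets \<mu> = sets borel" using eq by auto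
  obtain q :: "'a \<Rightarrow> nat" where q [measurable]: "q \<in> borel \<rightarrow>\<^sub>M count_space UNIV"
    and qd: "\<And>x y. q x = q y \<Longrightarrow> dist x y \<le> \<delta>"
    using countable_borel_cells[OF \<open>\<delta> > 0\<close>] by blast
  define p where "p i = measure \<mu> {x. q x = i}" for i
  have p0: "0 \<le> p i" for i by (simp add: p_def)
  define w where "w x y = (if q x = q y \<and> p (q x) > 0 then 1 / p (q x) else 0)" for x y
  have [measurable]: "(\<lambda>x. p (q x)) \<in> borel_measurable borel"
    by (rule measurable_compose[OF q]) simp
  \<comment> \<open>A countable disjunction over the cells makes the measurability of \<open>w\<close> evident.\<close>
  have w_alt: "w x y = (if (\<exists>i. q x = i \<and> q y = i) \<and> p (q x) > 0 then 1 / p (q x) else 0)" for x y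
    unfolding w_def by (rule if_cong) auto
  have [measurable]: "(\<lambda>z. w (fst z) (snd z)) \<in> borel_measurable (borel \<Otimes>\<^sub>M borel)"
    unfolding w_alt by measurable
  have [measurable]: "w x \<in> borel_measurable borel" for x
    unfolding w_alt[abs_def] by measurable
  have w_sym: "w x y = w y x" for x y by (auto simp: w_def)
  have w1: "(\<integral>\<^sup>+y. ennreal (w x y) \<partial>\<mu>) = 1" if "p (q x) > 0" for x
  proof -
    have "(\<integral>\<^sup>+y. ennreal (w x y) \<partial>\<mu>) = (\<integral>\<^sup>+y. ennreal (1 / p (q x)) * indicator {y. q y = q x} y \<partial>\<mu>)"
      using that by (intro nn_integral_cong) (auto simp: w_def split: split_indicator)
    also have "\<dots> = ennreal (1 / p (q x)) * emeasure \<mu> {y. q y = q x}"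
      by (rule nn_integral_cmult_indicator) measurable
    also have "\<dots> = ennreal (1 / p (q x)) * ennreal (p (q x))" by (simp add: M.emeasure_eq_measure p_def)
    also have "\<dots> = 1" using that by (simp flip: ennreal_mult)
    finally show ?thesis .
  qed
  have "AE x in \<mu>. \<forall>i. p i = 0 \<longrightarrow> q x \<noteq> i"
    unfolding AE_all_countable
  proof
    fix i
    show "AE x in \<mu>. p i = 0 \<longrightarrow> q x \<noteq> i"
    proof (cases "p i = 0")
      case True
      then have "{x. q x = i} \<in> null_sets \<mu>"
        by (auto simp: p_def null_sets_def M.emeasure_eq_measure s)
      then have "AE x in \<mu>. x \<notin> {x. q x = i}" by (rule AE_not_in)
      then show ?thesis by eventually_elim auto
    qed simp
  qed
  then have pos: "AE x in \<mu>. p (q x) > 0"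
    by eventually_elim (use p0 in \<open>auto simp: less_le\<close>)
  have posg: "AE z in \<pi>. p (q (g z)) > 0"
    using pos unfolding eq(1)[symmetric] by (subst (asm) AE_distr_iff) auto
  have posh: "AE z in \<pi>'. p (q (h z)) > 0"
    using pos unfolding eq(2)[symmetric] by (subst (asm) AE_distr_iff) auto
  have wg: "AE z in \<pi>. (\<integral>\<^sup>+z'. ennreal (w (g z) (h z')) \<partial>\<pi>') = 1"
    using posg
  proof eventually_elim
    case (elim z)
    have "(\<integral>\<^sup>+y. ennreal (w (g z) y) \<partial>\<mu>) = (\<integral>\<^sup>+z'. ennreal (w (g z) (h z')) \<partial>\<pi>')"
      unfolding eq(2)[symmetric] by (rule nn_integral_distr) auto
    then show ?case using w1[OF elim] by simp
  qed
  have wh: "AE z' in \<pi>'. (\<integral>\<^sup>+z. ennreal (w (g z) (h z')) \<partial>\<pi>) = 1"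
    using posh
  proof eventually_elim
    case (elim z')
    have "(\<integral>\<^sup>+y. ennreal (w (h z') y) \<partial>\<mu>) = (\<integral>\<^sup>+z. ennreal (w (h z') (g z)) \<partial>\<pi>)"
      unfolding eq(1)[symmetric] by (rule nn_integral_distr) auto
    then show ?case using w1[OF elim] by (simp add: w_sym)
  qed
  define W where "W z = ennreal (w (g (fst z)) (h (snd z)))" for z
  have [measurable]: "W \<in> borel_measurable (\<pi> \<Otimes>\<^sub>M \<pi>')"
    unfolding W_def w_alt by measurable
  define \<Gamma> where "\<Gamma> = density (\<pi> \<Otimes>\<^sub>M \<pi>') W"
  have sG [measurable_cong]: "sets \<Gamma> = sets (\<pi> \<Otimes>\<^sub>M \<pi>')" by (simp add: \<Gamma>_def)
  show ?thesis
  proof (rule that[of \<Gamma>])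
    show "distr \<Gamma> \<pi> fst = \<pi>"
    proof (rule measure_eqI)
      fix S assume "S \<in> sets (distr \<Gamma> \<pi> fst)"
      then have S [measurable]: "S \<in> sets \<pi>" by simp
      have "emeasure (distr \<Gamma> \<pi> fst) S = (\<integral>\<^sup>+z. indicator S z \<partial>distr \<Gamma> \<pi> fst)" by simp
      also have "\<dots> = (\<integral>\<^sup>+z. indicator S (fst z) \<partial>\<Gamma>)" by (rule nn_integral_distr) measurable
      also have "\<dots> = (\<integral>\<^sup>+z. W z * indicator S (fst z) \<partial>(\<pi> \<Otimes>\<^sub>M \<pi>'))"
        unfolding \<Gamma>_def by (rule nn_integral_density) measurable
      also have "\<dots> = (\<integral>\<^sup>+z. (\<integral>\<^sup>+z'. W (z, z') * indicator S z \<partial>\<pi>') \<partial>\<pi>)"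
        by (subst B.nn_integral_fst[symmetric]) auto
      also have "\<dots> = (\<integral>\<^sup>+z. indicator S z \<partial>\<pi>)"
      proof (rule nn_integral_cong_AE)
        show "AE z in \<pi>. (\<integral>\<^sup>+z'. W (z, z') * indicator S z \<partial>\<pi>') = indicator S z"
          using wg AE_space
        proof eventually_elim
          case (elim z)
          have [measurable]: "(\<lambda>z'. W (z, z')) \<in> borel_measurable \<pi>'" using elim by measurable
          show ?case using elim by (simp add: nn_integral_multc) (simp add: W_def)
        qed
      qed
      finally show "emeasure (distr \<Gamma> \<pi> fst) S = emeasure \<pi> S" by simp
    qed simp
    show "distr \<Gamma> \<pi>' snd = \<pi>'"
    proof (rule measure_eqI)
      fix S assume "S \<in> sets (distr \<Gamma> \<pi>' snd)"
      then have S [measurable]: "S \<in> sets \<pi>'" by simp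
      have "emeasure (distr \<Gamma> \<pi>' snd) S = (\<integral>\<^sup>+z. indicator S z \<partial>distr \<Gamma> \<pi>' snd)" by simp
      also have "\<dots> = (\<integral>\<^sup>+z. indicator S (snd z) \<partial>\<Gamma>)" by (rule nn_integral_distr) measurable
      also have "\<dots> = (\<integral>\<^sup>+z. W z * indicator S (snd z) \<partial>(\<pi> \<Otimes>\<^sub>M \<pi>'))"
        unfolding \<Gamma>_def by (rule nn_integral_density) measurable
      also have "\<dots> = (\<integral>\<^sup>+z'. (\<integral>\<^sup>+z. W (z, z') * indicator S z' \<partial>\<pi>) \<partial>\<pi>')"
        by (subst nn_integral_snd[symmetric]) auto
      also have "\<dots> = (\<integral>\<^sup>+z. indicator S z \<partial>\<pi>')"
      proof (rule nn_integral_cong_AE)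
        show "AE z' in \<pi>'. (\<integral>\<^sup>+z. W (z, z') * indicator S z' \<partial>\<pi>) = indicator S z'"
          using wh AE_space
        proof eventually_elim
          case (elim z')
          have [measurable]: "(\<lambda>z. W (z, z')) \<in> borel_measurable \<pi>" using elim by measurable
          show ?case using elim by (simp add: nn_integral_multc) (simp add: W_def)
        qed
      qed
      finally show "emeasure (distr \<Gamma> \<pi>' snd) S = emeasure \<pi>' S" by simp
    qed simp
    show "AE z in \<Gamma>. dist (g (fst z)) (h (snd z)) \<le> \<delta>"
      unfolding \<Gamma>_def by (subst AE_density) (auto simp: W_def w_def qd)
  qed (rule sG)
qed

text \<open>
The glued measure has four components, of which the two middle ones are \<open>\<delta>\<close>-close. Minkowski's
inequality along this chain bounds the cost between the outer components, and \<open>\<delta>\<close> is arbitrary.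
\<close>

lemma W2_triangle:
  assumes P: "\<mu> \<in> P2" "\<nu> \<in> P2" "\<rho> \<in> P2"
  shows "W2 \<mu> \<rho> \<le> W2 \<mu> \<nu> + W2 \<nu> \<rho>"
proof -
  have glued: "W2 \<mu> \<rho> \<le> sqrt (\<integral>(x, y). (norm (y - x))\<^sup>2 \<partial>\<pi>) + sqrt (\<integral>(x, y). (norm (y - x))\<^sup>2 \<partial>\<pi>') + \<delta>"
    if \<pi>: "\<pi> \<in> couplings \<mu> \<nu>" and \<pi>': "\<pi>' \<in> couplings \<nu> \<rho>" and \<delta>: "\<delta> > 0" for \<pi> \<pi>' \<delta>
  proof -
    note D = couplingD[OF \<pi> P(1,2)] couplingD[OF \<pi>' P(2,3)]
    have [measurable_cong]: "sets \<pi> = sets (borel \<Otimes>\<^sub>M borel)" "sets \<pi>' = sets (borel \<Otimes>\<^sub>M borel)"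
      using D by auto
    interpret A: prob_space \<pi> by fact
    interpret B: prob_space \<pi>' by fact
    obtain \<Gamma> where s: "sets \<Gamma> = sets (\<pi> \<Otimes>\<^sub>M \<pi>')" and d: "distr \<Gamma> \<pi> fst = \<pi>" "distr \<Gamma> \<pi>' snd = \<pi>'"
      and close: "AE z in \<Gamma>. dist (snd (fst z)) (fst (snd z)) \<le> \<delta>"
      by (rule approximate_gluing[OF D(1) D(6) \<delta>, of snd fst \<nu>]) (use D in auto)
    have [measurable_cong]: "sets \<Gamma> = sets ((borel \<Otimes>\<^sub>M borel) \<Otimes>\<^sub>M (borel \<Otimes>\<^sub>M borel))"
      unfolding s by (intro sets_pair_measure_cong D)
    have m1 [measurable]: "fst \<in> \<Gamma> \<rightarrow>\<^sub>M \<pi>" and m2 [measurable]: "snd \<in> \<Gamma> \<rightarrow>\<^sub>M \<pi>'"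
      by (simp_all cong: measurable_cong_sets add: s)
    interpret G: prob_space \<Gamma>
      by (rule prob_space_distrD[of fst \<Gamma> \<pi>]) (simp_all add: d A.prob_space_axioms)
    define f where "f z = norm (snd (fst z) - fst (fst z))" for z :: "('a \<times> 'a) \<times> ('a \<times> 'a)"
    define g where "g z = norm (snd (snd z) - fst (snd z))" for z :: "('a \<times> 'a) \<times> ('a \<times> 'a)"
    have [measurable]: "f \<in> borel_measurable \<Gamma>" "g \<in> borel_measurable \<Gamma>"
      unfolding f_def g_def by measurable
    have f2: "integrable \<Gamma> (\<lambda>z. (f z)\<^sup>2)" "(\<integral>z. (f z)\<^sup>2 \<partial>\<Gamma>) = (\<integral>(x, y). (norm (y - x))\<^sup>2 \<partial>\<pi>)"
    proof -
      have "integrable (distr \<Gamma> \<pi> fst) (\<lambda>(x, y). (norm (y - x))\<^sup>2)" using D(5) d by simp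
      then show "integrable \<Gamma> (\<lambda>z. (f z)\<^sup>2)"
        by (subst (asm) integrable_distr_eq) (auto simp: f_def split_def)
      have "(\<integral>(x, y). (norm (y - x))\<^sup>2 \<partial>distr \<Gamma> \<pi> fst) = (\<integral>z. (f z)\<^sup>2 \<partial>\<Gamma>)"
        by (subst integral_distr) (auto simp: f_def split_def)
      then show "(\<integral>z. (f z)\<^sup>2 \<partial>\<Gamma>) = (\<integral>(x, y). (norm (y - x))\<^sup>2 \<partial>\<pi>)" using d by simp
    qed
    have g2: "integrable \<Gamma> (\<lambda>z. (g z)\<^sup>2)" "(\<integral>z. (g z)\<^sup>2 \<partial>\<Gamma>) = (\<integral>(x, y). (norm (y - x))\<^sup>2 \<partial>\<pi>')"
    proof -
      have "integrable (distr \<Gamma> \<pi>' snd) (\<lambda>(x, y). (norm (y - x))\<^sup>2)" using D(10) d by simp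
      then show "integrable \<Gamma> (\<lambda>z. (g z)\<^sup>2)"
        by (subst (asm) integrable_distr_eq) (auto simp: g_def split_def)
      have "(\<integral>(x, y). (norm (y - x))\<^sup>2 \<partial>distr \<Gamma> \<pi>' snd) = (\<integral>z. (g z)\<^sup>2 \<partial>\<Gamma>)"
        by (subst integral_distr) (auto simp: g_def split_def)
      then show "(\<integral>z. (g z)\<^sup>2 \<partial>\<Gamma>) = (\<integral>(x, y). (norm (y - x))\<^sup>2 \<partial>\<pi>')" using d by simp
    qed
    have g\<delta>: "integrable \<Gamma> (\<lambda>z. (g z + \<delta>)\<^sup>2)"
        "sqrt (\<integral>z. (g z + \<delta>)\<^sup>2 \<partial>\<Gamma>) \<le> sqrt (\<integral>z. (g z)\<^sup>2 \<partial>\<Gamma>) + sqrt (\<integral>z. \<delta>\<^sup>2 \<partial>\<Gamma>)"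
      by (rule L2_cauchy_schwarz_minkowski[of g \<Gamma> "\<lambda>_. \<delta>"]; use \<delta> g2 in \<open>auto simp: g_def\<close>)+
    have fg\<delta>: "integrable \<Gamma> (\<lambda>z. (f z + (g z + \<delta>))\<^sup>2)"
        "sqrt (\<integral>z. (f z + (g z + \<delta>))\<^sup>2 \<partial>\<Gamma>) \<le> sqrt (\<integral>z. (f z)\<^sup>2 \<partial>\<Gamma>) + sqrt (\<integral>z. (g z + \<delta>)\<^sup>2 \<partial>\<Gamma>)"
      by (rule L2_cauchy_schwarz_minkowski[of f \<Gamma> "\<lambda>z. g z + \<delta>"]; use \<delta> g\<delta>(1) f2(1) in \<open>auto simp: f_def g_def\<close>)+
    define \<sigma> where "\<sigma> = distr \<Gamma> (borel \<Otimes>\<^sub>M borel) (\<lambda>z. (fst (fst z), snd (snd z)))"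
    have "distr \<sigma> borel fst = distr (distr \<Gamma> \<pi> fst) borel fst"
      unfolding \<sigma>_def by (subst (1 2) distr_distr) (auto simp: o_def)
    moreover have "distr \<sigma> borel snd = distr (distr \<Gamma> \<pi>' snd) borel snd"
      unfolding \<sigma>_def by (subst (1 2) distr_distr) (auto simp: o_def)
    ultimately have \<sigma>: "\<sigma> \<in> couplings \<mu> \<rho>"
      using D d by (auto simp: couplings_def \<sigma>_def)
    have "(\<integral>(x, y). (norm (y - x))\<^sup>2 \<partial>\<sigma>) = (\<integral>z. (norm (snd (snd z) - fst (fst z)))\<^sup>2 \<partial>\<Gamma>)"
      unfolding \<sigma>_def by (subst integral_distr) (auto simp: split_def)
    also have "\<dots> \<le> (\<integral>z. (f z + (g z + \<delta>))\<^sup>2 \<partial>\<Gamma>)"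
    proof (rule integral_mono_AE')
      show "AE z in \<Gamma>. (norm (snd (snd z) - fst (fst z)))\<^sup>2 \<le> (f z + (g z + \<delta>))\<^sup>2"
        using close
      proof eventually_elim
        case (elim z)
        have "norm (fst (snd z) - snd (fst z)) \<le> \<delta>"
          using elim by (simp add: dist_norm norm_minus_commute)
        moreover have "snd (snd z) - fst (fst z) = (snd (fst z) - fst (fst z))
            + ((snd (snd z) - fst (snd z)) + (fst (snd z) - snd (fst z)))" by simp
        ultimately have "norm (snd (snd z) - fst (fst z)) \<le> f z + (g z + \<delta>)"
          unfolding f_def g_def
          by (metis (no_types) add_left_mono norm_triangle_le norm_triangle_mono order_refl)
        then show ?case by (rule power_mono) simp
      qed
    qed (use fg\<delta> in auto)
    finally have "sqrt (\<integral>(x, y). (norm (y - x))\<^sup>2 \<partial>\<sigma>) \<le> sqrt (\<integral>z. (f z + (g z + \<delta>))\<^sup>2 \<partial>\<Gamma>)" by simp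
    also note fg\<delta>(2)
    also note g\<delta>(2)
    also have "sqrt (\<integral>z. \<delta>\<^sup>2 \<partial>\<Gamma>) = \<delta>" using \<delta> by (simp add: G.prob_space)
    finally show ?thesis using W2_le[OF \<sigma>] f2 g2 by simp
  qed
  have "W2 \<mu> \<rho> - W2 \<mu> \<nu> \<le> W2 \<nu> \<rho>"
  proof (rule W2_greatest[OF P(2,3)])
    fix \<pi>' assume \<pi>': "\<pi>' \<in> couplings \<nu> \<rho>"
    have "W2 \<mu> \<rho> - sqrt (\<integral>(x, y). (norm (y - x))\<^sup>2 \<partial>\<pi>') \<le> W2 \<mu> \<nu>"
    proof (rule W2_greatest[OF P(1,2)])
      fix \<pi> assume \<pi>: "\<pi> \<in> couplings \<mu> \<nu>"
      have "W2 \<mu> \<rho> \<le> sqrt (\<integral>(x, y). (norm (y - x))\<^sup>2 \<partial>\<pi>) + sqrt (\<integral>(x, y). (norm (y - x))\<^sup>2 \<partial>\<pi>')"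
        by (rule field_le_epsilon) (rule glued[OF \<pi> \<pi>'])
      then show "W2 \<mu> \<rho> - sqrt (\<integral>(x, y). (norm (y - x))\<^sup>2 \<partial>\<pi>') \<le> sqrt (\<integral>(x, y). (norm (y - x))\<^sup>2 \<partial>\<pi>)"
        by simp
    qed
    then show "W2 \<mu> \<rho> - W2 \<mu> \<nu> \<le> sqrt (\<integral>(x, y). (norm (y - x))\<^sup>2 \<partial>\<pi>')" by simp
  qed
  then show ?thesis by simp
qed

text \<open>
Each coupling bounds the difference by \<open>L\<close> times its mean displacement, hence by \<open>L\<close> times the root of
its cost.
\<close>

lemma lipschitz_integral_diff_le_W2:
  assumes P: "\<mu> \<in> P2" "\<nu> \<in> P2" and lip: "L-lipschitz_on UNIV \<phi>" and bd: "\<And>x. \<bar>\<phi> x\<bar> \<le> (k::real)" and L: "0 < L"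
  shows "(\<integral>x. \<phi> x \<partial>\<nu>) - (\<integral>x. \<phi> x \<partial>\<mu>) \<le> L * W2 \<mu> \<nu>"
proof -
  have "((\<integral>x. \<phi> x \<partial>\<nu>) - (\<integral>x. \<phi> x \<partial>\<mu>)) / L \<le> W2 \<mu> \<nu>"
  proof (rule W2_greatest[OF P])
    fix \<pi> assume \<pi>: "\<pi> \<in> couplings \<mu> \<nu>"
    note D = couplingD[OF this P]
    interpret prob_space \<pi> by fact
    note [measurable_cong] = D(2)
    have [measurable]: "\<phi> \<in> borel_measurable borel" by (rule borel_measurable_lipschitz[OF lip])
    have i: "integrable \<pi> (\<lambda>z. \<phi> (fst z))" "integrable \<pi> (\<lambda>z. \<phi> (snd z))"
      by (rule integrable_const_bound[where B=k]; use bd in auto)+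
    have sq: "integrable \<pi> (\<lambda>z. (norm (snd z - fst z))\<^sup>2)" using D(5) by (simp add: split_def)
    have CS: "(\<integral>z. norm (snd z - fst z) * 1 \<partial>\<pi>) \<le> sqrt (\<integral>z. (norm (snd z - fst z))\<^sup>2 \<partial>\<pi>) * sqrt (\<integral>z. 1\<^sup>2 \<partial>\<pi>)"
      "integrable \<pi> (\<lambda>z. norm (snd z - fst z) * 1)"
      by (rule L2_cauchy_schwarz_minkowski[of "\<lambda>z. norm (snd z - fst z)" \<pi> "\<lambda>_. 1"]; use sq in auto)+
    have "(\<integral>x. \<phi> x \<partial>\<nu>) - (\<integral>x. \<phi> x \<partial>\<mu>) = (\<integral>z. \<phi> (snd z) - \<phi> (fst z) \<partial>\<pi>)"
      using i unfolding D(3)[symmetric] D(4)[symmetric] by (simp add: integral_distr)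
    also have "\<dots> \<le> (\<integral>z. L * norm (snd z - fst z) \<partial>\<pi>)"
    proof (rule integral_mono)
      fix z show "\<phi> (snd z) - \<phi> (fst z) \<le> L * norm (snd z - fst z)"
        using lipschitz_onD[OF lip, of "snd z" "fst z"] by (simp add: dist_norm)
    qed (use i CS in auto)
    also have "\<dots> \<le> L * sqrt (\<integral>z. (norm (snd z - fst z))\<^sup>2 \<partial>\<pi>)"
      using CS L by (simp add: prob_space)
    finally show "((\<integral>x. \<phi> x \<partial>\<nu>) - (\<integral>x. \<phi> x \<partial>\<mu>)) / L \<le> sqrt (\<integral>(x, y). (norm (y - x))\<^sup>2 \<partial>\<pi>)"
      using L by (simp add: split_def pos_divide_le_eq mult.commute)
  qed
  then show ?thesis using L by (simp add: pos_divide_le_eq mult.commute)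
qed

text \<open>
For a fixed bounded Lipschitz \<open>\<phi>\<close> the dual inequality is stable under \<open>W\<^sub>2\<close>-limits, because
\<open>\<nu> \<mapsto> \<integral>\<phi> d\<nu>\<close> is Lipschitz for \<open>W\<^sub>2\<close>.
\<close>

theorem rel_entropy_lower_semicontinuous:
  assumes \<mu>: "prob_space \<mu>" "sets \<mu> = sets borel" and P: "\<And>n. x n \<in> P2" "y \<in> P2"
    and lim: "(\<lambda>n::nat. W2 (x n) y) \<longlonglongrightarrow> 0" and le: "\<And>n. rel_entropy (x n) \<mu> \<le> ereal c"
  shows "rel_entropy y \<mu> \<le> ereal c"
proof (rule rel_entropy_le_if_lipschitz_variational_bound[OF \<mu>(1) _ \<mu>(2)])
  show "prob_space y" "sets y = sets borel" using P by (auto simp: P2_def)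
  fix \<phi> :: "'a \<Rightarrow> real" and k L assume lip: "L-lipschitz_on UNIV \<phi>" and bd: "\<And>x. \<bar>\<phi> x\<bar> \<le> k"
  have L: "0 \<le> L" using lip by (rule lipschitz_on_nonneg)
  have lip': "(L + 1)-lipschitz_on UNIV \<phi>" by (rule lipschitz_on_mono[OF lip]) auto
  have \<phi>: "\<phi> \<in> borel_measurable \<mu>"
    using borel_measurable_lipschitz[OF lip] by (simp cong: measurable_cong_sets add: \<mu>(2))
  have "(\<integral>z. \<phi> z \<partial>y) \<le> (L + 1) * W2 (x n) y + (c + ln (\<integral>z. exp (\<phi> z) \<partial>\<mu>))" for n
  proof -
    have "(\<integral>z. \<phi> z \<partial>y) - (\<integral>z. \<phi> z \<partial>x n) \<le> (L + 1) * W2 (x n) y"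
      by (rule lipschitz_integral_diff_le_W2[OF P(1) P(2) lip' bd]) (use L in simp)
    moreover have "(\<integral>z. \<phi> z \<partial>x n) \<le> c + ln (\<integral>z. exp (\<phi> z) \<partial>\<mu>)"
      by (rule variational_bound_if_rel_entropy_le[OF \<mu>(1) _ _ le \<phi> bd]) (use P(1)[of n] \<mu> in \<open>auto simp: P2_def\<close>)
    ultimately show ?thesis by linarith
  qed
  moreover have "(\<lambda>n. (L + 1) * W2 (x n) y + (c + ln (\<integral>z. exp (\<phi> z) \<partial>\<mu>)))
      \<longlonglongrightarrow> (L + 1) * 0 + (c + ln (\<integral>z. exp (\<phi> z) \<partial>\<mu>))"
    by (intro tendsto_intros lim)
  ultimately show "(\<integral>z. \<phi> z \<partial>y) \<le> c + ln (\<integral>z. exp (\<phi> z) \<partial>\<mu>)"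
    by (intro LIMSEQ_le_const[of "\<lambda>n. (L + 1) * W2 (x n) y + (c + ln (\<integral>z. exp (\<phi> z) \<partial>\<mu>))"]) auto
qed

section \<open>Strongly convex potentials and interpolation with the Gibbs measure\<close>

lemma grad_has_derivative:
  assumes "V differentiable (at x)"
  shows "(V has_derivative (\<lambda>h. grad V x \<bullet> h)) (at x)"
proof -
  obtain F where F: "(V has_derivative F) (at x)" using assms by (auto simp: differentiable_def)
  then interpret F: bounded_linear F by (rule has_derivative_bounded_linear)
  define D where "D = (\<Sum>b\<in>Basis. F b *\<^sub>R b)"
  have "F h = h \<bullet> D" for h
  proof -
    have "F h = F (\<Sum>b\<in>Basis. (h \<bullet> b) *\<^sub>R b)" by (simp add: euclidean_representation)
    also have "\<dots> = (\<Sum>b\<in>Basis. (h \<bullet> b) * F b)" by (simp add: F.sum F.scaleR)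
    also have "\<dots> = h \<bullet> D" by (simp add: D_def inner_sum_right mult.commute)
    finally show ?thesis .
  qed
  then have "F = (\<lambda>h. h \<bullet> D)" by blast
  then have "GDERIV V x :> D" using F unfolding gderiv_def by simp
  moreover have "D' = D" if "GDERIV V x :> D'" for D'
  proof -
    have "(\<lambda>h. h \<bullet> D') = (\<lambda>h. h \<bullet> D)"
      using that calculation unfolding gderiv_def by (rule has_derivative_unique)
    then show ?thesis by (metis vector_eq_ldot)
  qed
  ultimately have "GDERIV V x :> grad V x" unfolding grad_def by (rule theI)
  then show ?thesis by (simp add: gderiv_def inner_commute)
qed

text \<open>
Integrate the lower bound on the Hessian twice along the segment from \<open>x\<close> to \<open>z\<close>.
\<close>

lemma quadratic_lower_bound_if_hess_ge:
  fixes V :: "'a::euclidean_space \<Rightarrow> real"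
  assumes V: "C2_function V" and hess: "\<And>x v. R * (norm v)\<^sup>2 \<le> hess V x v \<bullet> v"
  shows "V x + grad V x \<bullet> (z - x) + R / 2 * (norm (z - x))\<^sup>2 \<le> V z"
proof -
  define w where "w = z - x"
  have line: "((\<lambda>t. x + t *\<^sub>R w) has_derivative (\<lambda>h. h *\<^sub>R w)) (at t)" for t
    by (auto intro!: derivative_eq_intros)
  have V': "((\<lambda>t. V (x + t *\<^sub>R w)) has_real_derivative (grad V (x + t *\<^sub>R w) \<bullet> w)) (at t)" for t
  proof -
    have "(V has_derivative (\<lambda>h. grad V (x + t *\<^sub>R w) \<bullet> h)) (at (x + t *\<^sub>R w))"
      using V by (intro grad_has_derivative) (auto simp: C2_function_def)
    moreover have "(\<lambda>h. grad V (x + t *\<^sub>R w) \<bullet> (h *\<^sub>R w)) = (*) (grad V (x + t *\<^sub>R w) \<bullet> w)"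
      by (simp add: fun_eq_iff)
    ultimately show ?thesis
      unfolding has_field_derivative_def by (metis has_derivative_compose[OF line])
  qed
  have V'': "((\<lambda>t. grad V (x + t *\<^sub>R w) \<bullet> w) has_real_derivative (hess V (x + t *\<^sub>R w) w \<bullet> w)) (at t)" for t
  proof -
    let ?H = "hess V (x + t *\<^sub>R w)"
    have H: "(grad V has_derivative ?H) (at (x + t *\<^sub>R w))"
      using V unfolding hess_def C2_function_def by (simp add: frechet_derivative_works[symmetric])
    interpret H: bounded_linear ?H using H by (rule has_derivative_bounded_linear)
    have "(\<lambda>h. ?H (h *\<^sub>R w) \<bullet> w) = (*) (?H w \<bullet> w)"
      by (simp add: fun_eq_iff H.scaleR)
    then show ?thesis
      using has_derivative_inner_left[OF has_derivative_compose[OF line H], of w]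
      unfolding has_field_derivative_def by simp
  qed
  have mono: "grad V x \<bullet> w + R * t * (norm w)\<^sup>2 \<le> grad V (x + t *\<^sub>R w) \<bullet> w" if "0 \<le> t" for t
  proof -
    let ?k = "\<lambda>t. grad V (x + t *\<^sub>R w) \<bullet> w - R * t * (norm w)\<^sup>2"
    have "?k 0 \<le> ?k t"
    proof (rule DERIV_nonneg_imp_nondecreasing[where f="?k", OF that])
      fix r
      have "(?k has_real_derivative (hess V (x + r *\<^sub>R w) w \<bullet> w - R * (norm w)\<^sup>2)) (at r)"
        by (auto intro!: derivative_eq_intros V'')
      then show "\<exists>y. (?k has_real_derivative y) (at r) \<and> 0 \<le> y" using hess by auto
    qed
    then show ?thesis by simp
  qed
  let ?k = "\<lambda>t. V (x + t *\<^sub>R w) - t * (grad V x \<bullet> w) - R / 2 * t\<^sup>2 * (norm w)\<^sup>2"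
  have "?k 0 \<le> ?k 1"
  proof (rule DERIV_nonneg_imp_nondecreasing[where f="?k"])
    fix r :: real assume r: "0 \<le> r"
    have "(?k has_real_derivative (grad V (x + r *\<^sub>R w) \<bullet> w - grad V x \<bullet> w - R * r * (norm w)\<^sup>2)) (at r)"
      by (auto intro!: derivative_eq_intros V')
    then show "\<exists>y. (?k has_real_derivative y) (at r) \<and> 0 \<le> y" using mono[OF r] by auto
  qed simp
  then show ?thesis by (simp add: w_def)
qed

text \<open>
The graph of \<open>V\<close> lies above its tangent at the interpolated point, and averaging this at \<open>x\<close> and \<open>z\<close>
cancels the slopes.
\<close>

lemma convex_if_hess_nonneg:
  fixes V :: "'a::euclidean_space \<Rightarrow> real"
  assumes V: "C2_function V" and hess: "\<And>x v. 0 \<le> hess V x v \<bullet> v" and s: "0 \<le> s" "s \<le> 1"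
  shows "V ((1 - s) *\<^sub>R x + s *\<^sub>R z) \<le> (1 - s) * V x + s * V z"
proof -
  define p where "p = (1 - s) *\<^sub>R x + s *\<^sub>R z"
  have tangent: "V p + grad V p \<bullet> (y - p) \<le> V y" for y
    using quadratic_lower_bound_if_hess_ge[OF V, of 0 p y] hess by simp
  have *: "x - p = s *\<^sub>R (x - z)" "z - p = (1 - s) *\<^sub>R (z - x)"
    by (simp_all add: p_def algebra_simps)
  have "(1 - s) * (grad V p \<bullet> (x - p)) + s * (grad V p \<bullet> (z - p)) = 0"
    unfolding * by (simp add: inner_diff_right algebra_simps)
  moreover have "(1 - s) * (V p + grad V p \<bullet> (x - p)) + s * (V p + grad V p \<bullet> (z - p))
      \<le> (1 - s) * V x + s * V z"
    using s tangent by (intro add_mono mult_left_mono) auto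
  ultimately show ?thesis unfolding p_def[symmetric] by (simp add: algebra_simps)
qed

text \<open>
Two ways of splitting \<open>|\<nabla>V(x)| |z-x|\<close> by Young's inequality in the quadratic lower bound: the first spends
the whole quadratic term, the second keeps half of it.
\<close>

lemma energy_gap:
  fixes V :: "'a::euclidean_space \<Rightarrow> real"
  assumes V: "C2_function V" and hess: "\<And>x v. R * (norm v)\<^sup>2 \<le> hess V x v \<bullet> v" and R: "0 < R"
  shows "V x - V z \<le> (norm (grad V x))\<^sup>2 / (2 * R)"
    and "R / 4 * (norm (z - x))\<^sup>2 \<le> V z - V x + (norm (grad V x))\<^sup>2 / R"
proof -
  let ?a = "norm (grad V x)" and ?b = "norm (z - x)"
  have "- (grad V x \<bullet> (z - x)) \<le> ?a * ?b"
    using Cauchy_Schwarz_ineq2[of "grad V x" "z - x"] by linarith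
  then have *: "V x - V z \<le> ?a * ?b - R / 2 * ?b\<^sup>2"
    using quadratic_lower_bound_if_hess_ge[OF V hess, of x z] by linarith
  have "0 \<le> (?a - R * ?b)\<^sup>2 / (2 * R)" using R by simp
  also have "\<dots> = ?a\<^sup>2 / (2 * R) - ?a * ?b + R / 2 * ?b\<^sup>2"
    using R by (simp add: power2_eq_square field_simps)
  finally show "V x - V z \<le> ?a\<^sup>2 / (2 * R)" using * by linarith
  have "0 \<le> (?a - R / 2 * ?b)\<^sup>2 / R" using R by simp
  also have "\<dots> = ?a\<^sup>2 / R - ?a * ?b + R / 4 * ?b\<^sup>2"
    using R by (simp add: power2_eq_square field_simps)
  finally show "R / 4 * ?b\<^sup>2 \<le> V z - V x + ?a\<^sup>2 / R" using * by linarith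
qed

lemma nn_integral_lborel_affine:
  fixes t :: "'a::euclidean_space"
  assumes [measurable]: "F \<in> borel_measurable borel" and c: "c \<noteq> 0"
  shows "(\<integral>\<^sup>+y. F y \<partial>lborel) = (\<integral>\<^sup>+z. ennreal (\<bar>c\<bar> ^ DIM('a)) * F (t + c *\<^sub>R z) \<partial>lborel)"
  by (subst lborel_affine[OF c, of t])
    (simp add: nn_integral_density nn_integral_distr nn_integral_cmult)

lemma C2_borel_measurable:
  assumes "C2_function V" shows "V \<in> borel_measurable borel"
proof -
  have "continuous_on UNIV V"
    using assms differentiable_imp_continuous_within
    by (auto simp: C2_function_def continuous_on_eq_continuous_within)
  then show ?thesis by (rule borel_measurable_continuous_onI)
qed

lemma sets_gibbs [simp, measurable_cong]: "sets (gibbs V) = sets borel"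
  by (simp add: gibbs_def)

lemma gibbs_normalised:
  fixes V :: "'a::euclidean_space \<Rightarrow> real"
  assumes "has_bochner_integral lborel (\<lambda>x. exp (- V x)) 1"
  shows "(\<integral>\<^sup>+x. ennreal (exp (- V x)) \<partial>lborel) = 1" and "prob_space (gibbs V)"
proof -
  show *: "(\<integral>\<^sup>+x. ennreal (exp (- V x)) \<partial>lborel) = 1"
    using assms by (subst nn_integral_eq_integral) (auto simp: has_bochner_integral_iff)
  have [measurable]: "(\<lambda>x. exp (- V x)) \<in> borel_measurable borel"
    using assms by (auto simp: has_bochner_integral_iff dest: borel_measurable_integrable)
  show "prob_space (gibbs V)"
    by (rule prob_spaceI) (simp add: gibbs_def emeasure_density *)
qed

text \<open>
Let \<open>m(z)\<close> be the midpoint of \<open>x\<close> and \<open>z\<close>, and \<open>W = V(z) - V(x)\<close>. By convexity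
\<open>exp(-V(m(z))) \<ge> exp(-V(z)) exp(W/2) \<ge> exp(-V(z)) W/2\<close>, and the integral of the left hand side is \<open>2\<^sup>n\<close> by the change of
variables \<open>z \<mapsto> m(z)\<close>. So \<open>W\<close> has mean at most \<open>2\<^bsup>n+1\<^esup>\<close> under the Gibbs measure, and \<open>energy_gap\<close> turns this
into a bound on \<open>|z-x|\<^sup>2\<close> that involves \<open>V\<close> through \<open>|\<nabla>V(x)|\<close> only.
\<close>

lemma gibbs_second_moment:
  fixes V :: "'a::euclidean_space \<Rightarrow> real"
  assumes V: "C2_function V" and hess: "\<And>x v. R * (norm v)\<^sup>2 \<le> hess V x v \<bullet> v" and R: "0 < R"
    and mass: "has_bochner_integral lborel (\<lambda>x. exp (- V x)) 1"
  shows "(\<integral>\<^sup>+z. ennreal ((norm (z - x))\<^sup>2) \<partial>gibbs V)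
     \<le> ennreal (4 / R * (2 ^ (DIM('a) + 1) + (norm (grad V x))\<^sup>2 / R))"
proof -
  note [measurable] = C2_borel_measurable[OF V]
  have hess0: "0 \<le> hess V x v \<bullet> v" for x v
    using hess[of v x] R by (intro order_trans[OF _ hess]) simp
  define G where "G = (norm (grad V x))\<^sup>2 / R"
  have G: "0 \<le> G" using R by (simp add: G_def)
  define m where "m z = (1 / 2) *\<^sub>R x + (1 / 2) *\<^sub>R z" for z
  have pw: "exp (- V z) * (norm (z - x))\<^sup>2 \<le> 4 / R * (2 * exp (- V (m z)) + G * exp (- V z))" for z
  proof -
    define W where "W = V z - V x"
    have "V (m z) \<le> V z - W / 2"
      using convex_if_hess_nonneg[OF V hess0, of "1/2" x z] by (simp add: m_def W_def field_simps)
    then have "exp (- V z) * exp (W / 2) \<le> exp (- V (m z))" by (simp flip: exp_add)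
    moreover have "exp (- V z) * (W / 2) \<le> exp (- V z) * exp (W / 2)"
      using exp_ge_add_one_self[of "W / 2"]
      by (intro mult_left_mono) (linarith, simp)
    ultimately have "exp (- V z) * (W / 2) \<le> exp (- V (m z))" by (rule order_trans[rotated])
    then have "exp (- V z) * W \<le> 2 * exp (- V (m z))" by simp
    moreover have "exp (- V z) * (R / 4 * (norm (z - x))\<^sup>2) \<le> exp (- V z) * (W + G)"
      using energy_gap(2)[OF V hess R, of z x] by (intro mult_left_mono) (auto simp: W_def G_def)
    ultimately have "R / 4 * (exp (- V z) * (norm (z - x))\<^sup>2) \<le> 2 * exp (- V (m z)) + G * exp (- V z)"
      by (simp add: algebra_simps)
    then show ?thesis using R by (simp add: field_simps)
  qed
  have half: "(\<integral>\<^sup>+z. ennreal (exp (- V (m z))) \<partial>lborel) = ennreal (2 ^ DIM('a))"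
  proof -
    have "1 = (\<integral>\<^sup>+z. ennreal (\<bar>1 / 2\<bar> ^ DIM('a)) * ennreal (exp (- V (m z))) \<partial>lborel)"
      unfolding gibbs_normalised(1)[OF mass, symmetric] m_def
      by (rule nn_integral_lborel_affine) auto
    also have "\<dots> = ennreal ((1 / 2) ^ DIM('a)) * (\<integral>\<^sup>+z. ennreal (exp (- V (m z))) \<partial>lborel)"
      unfolding m_def by (subst nn_integral_cmult) auto
    finally have "ennreal (2 ^ DIM('a)) * 1 = ennreal (2 ^ DIM('a)) * (ennreal ((1 / 2) ^ DIM('a)) *
        (\<integral>\<^sup>+z. ennreal (exp (- V (m z))) \<partial>lborel))" by simp
    also have "\<dots> = ennreal (2 ^ DIM('a) * (1 / 2) ^ DIM('a)) * (\<integral>\<^sup>+z. ennreal (exp (- V (m z))) \<partial>lborel)"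
      by (subst ennreal_mult) (auto simp: mult.assoc)
    finally show ?thesis by (simp add: power_one_over)
  qed
  have "(\<integral>\<^sup>+z. ennreal ((norm (z - x))\<^sup>2) \<partial>gibbs V)
      = (\<integral>\<^sup>+z. ennreal (exp (- V z) * (norm (z - x))\<^sup>2) \<partial>lborel)"
    unfolding gibbs_def by (subst nn_integral_density) (auto simp: ennreal_mult)
  also have "\<dots> \<le> (\<integral>\<^sup>+z. ennreal (4 / R * (2 * exp (- V (m z)) + G * exp (- V z))) \<partial>lborel)"
    by (intro nn_integral_mono ennreal_leI pw)
  also have "\<dots> = (\<integral>\<^sup>+z. ennreal (4 / R * 2) * ennreal (exp (- V (m z)))
      + ennreal (4 / R * G) * ennreal (exp (- V z)) \<partial>lborel)"
    using R G by (intro nn_integral_cong) (simp add: algebra_simps flip: ennreal_mult ennreal_plus)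
  also have "\<dots> = ennreal (4 / R * 2) * ennreal (2 ^ DIM('a)) + ennreal (4 / R * G) * 1"
    unfolding half[symmetric] gibbs_normalised(1)[OF mass, symmetric] m_def
    by (simp add: nn_integral_add nn_integral_cmult)
  also have "\<dots> = ennreal (4 / R * (2 ^ (DIM('a) + 1) + G))"
    using R G by (simp add: algebra_simps flip: ennreal_mult ennreal_plus)
  finally show ?thesis by (simp add: G_def)
qed

lemma gibbs_P2:
  fixes V :: "'a::euclidean_space \<Rightarrow> real"
  assumes V: "C2_function V" and hess: "\<And>x v. R * (norm v)\<^sup>2 \<le> hess V x v \<bullet> v" and R: "0 < R"
    and mass: "has_bochner_integral lborel (\<lambda>x. exp (- V x)) 1"
  shows "gibbs V \<in> P2"
proof -
  have "integrable (gibbs V) (\<lambda>x. (norm x)\<^sup>2)"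
  proof (rule integrableI_bounded)
    have "(\<integral>\<^sup>+z. ennreal ((norm (z - 0))\<^sup>2) \<partial>gibbs V)
        \<le> ennreal (4 / R * (2 ^ (DIM('a) + 1) + (norm (grad V 0))\<^sup>2 / R))"
      by (rule gibbs_second_moment[OF assms])
    also have "\<dots> < \<infinity>" by simp
    finally show "(\<integral>\<^sup>+z. ennreal (norm ((norm z)\<^sup>2)) \<partial>gibbs V) < \<infinity>" by simp
  qed measurable
  then show ?thesis using gibbs_normalised(2)[OF mass] by (simp add: P2_def)
qed

text \<open>
The point at time \<open>s\<close> of the interpolation from \<open>\<nu>\<close> to \<open>\<mu>\<close> along straight lines. The coupling is the
product rather than an optimal one, so that conditionally on the initial point the law is a copy of \<open>\<mu>\<close>
shrunk by the factor \<open>s\<close>.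
\<close>

definition interpolant :: "real \<Rightarrow> 'a::euclidean_space measure \<Rightarrow> 'a measure \<Rightarrow> 'a measure" where
  "interpolant s \<nu> \<mu> = distr (\<nu> \<Otimes>\<^sub>M \<mu>) borel (\<lambda>z. (1 - s) *\<^sub>R fst z + s *\<^sub>R snd z)"

lemma interpolant_P2:
  assumes P: "\<nu> \<in> P2" "\<mu> \<in> P2" and s: "0 \<le> s" "s \<le> 1"
  shows "interpolant s \<nu> \<mu> \<in> P2"
proof -
  note D = couplingD[OF product_coupling[OF P] P]
  note [measurable_cong] = D(2)
  interpret prob_space "\<nu> \<Otimes>\<^sub>M \<mu>" by (rule D)
  have "integrable (distr (\<nu> \<Otimes>\<^sub>M \<mu>) borel fst) (\<lambda>x. (norm x)\<^sup>2)"
    "integrable (distr (\<nu> \<Otimes>\<^sub>M \<mu>) borel snd) (\<lambda>x. (norm x)\<^sup>2)"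
    unfolding D(3,4) using P by (auto simp: P2_def)
  then have i: "integrable (\<nu> \<Otimes>\<^sub>M \<mu>) (\<lambda>z. (norm (fst z))\<^sup>2)" "integrable (\<nu> \<Otimes>\<^sub>M \<mu>) (\<lambda>z. (norm (snd z))\<^sup>2)"
    by (auto simp: integrable_distr_eq)
  have "integrable (\<nu> \<Otimes>\<^sub>M \<mu>) (\<lambda>z. (norm ((1 - s) *\<^sub>R fst z + s *\<^sub>R snd z))\<^sup>2)"
  proof (rule Bochner_Integration.integrable_bound)
    show "integrable (\<nu> \<Otimes>\<^sub>M \<mu>) (\<lambda>z. (norm (fst z) + norm (snd z))\<^sup>2)"
      by (rule L2_cauchy_schwarz_minkowski(3)) (use i in auto)
    show "AE z in \<nu> \<Otimes>\<^sub>M \<mu>. norm ((norm ((1 - s) *\<^sub>R fst z + s *\<^sub>R snd z))\<^sup>2) \<le> norm ((norm (fst z) + norm (snd z))\<^sup>2)"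
    proof (rule AE_I2)
      fix z :: "'a \<times> 'a"
      have "norm ((1 - s) *\<^sub>R fst z + s *\<^sub>R snd z) \<le> (1 - s) * norm (fst z) + s * norm (snd z)"
        using s norm_triangle_ineq[of "(1 - s) *\<^sub>R fst z" "s *\<^sub>R snd z"] by simp
      also have "\<dots> \<le> 1 * norm (fst z) + 1 * norm (snd z)"
        using s by (intro add_mono mult_right_mono) auto
      finally have "(norm ((1 - s) *\<^sub>R fst z + s *\<^sub>R snd z))\<^sup>2 \<le> (norm (fst z) + norm (snd z))\<^sup>2"
        by (intro power_mono) auto
      then show "norm ((norm ((1 - s) *\<^sub>R fst z + s *\<^sub>R snd z))\<^sup>2) \<le> norm ((norm (fst z) + norm (snd z))\<^sup>2)"
        by simp
    qed
  qed measurable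
  then have "integrable (interpolant s \<nu> \<mu>) (\<lambda>x. (norm x)\<^sup>2)"
    unfolding interpolant_def by (subst integrable_distr_eq) auto
  moreover have "prob_space (interpolant s \<nu> \<mu>)"
    unfolding interpolant_def by (rule prob_space_distr) measurable
  ultimately show ?thesis by (simp add: P2_def interpolant_def)
qed

text \<open>
Transport \<open>X\<close> to \<open>(1-s) X + s Z\<close>: the displacement is \<open>s (Z - X)\<close>.
\<close>

lemma W2_interpolant_le:
  assumes P: "\<nu> \<in> P2" "\<mu> \<in> P2" and s: "0 \<le> s"
  shows "W2 \<nu> (interpolant s \<nu> \<mu>) \<le> s * sqrt (\<integral>(x, y). (norm (y - x))\<^sup>2 \<partial>(\<nu> \<Otimes>\<^sub>M \<mu>))"
proof -
  note D = couplingD[OF product_coupling[OF P] P]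
  note [measurable_cong] = D(2)
  let ?\<pi> = "distr (\<nu> \<Otimes>\<^sub>M \<mu>) (borel \<Otimes>\<^sub>M borel) (\<lambda>z. (fst z, (1 - s) *\<^sub>R fst z + s *\<^sub>R snd z))"
  have "?\<pi> \<in> couplings \<nu> (interpolant s \<nu> \<mu>)"
    using D(3) by (auto simp: couplings_def distr_distr o_def interpolant_def)
  then have "W2 \<nu> (interpolant s \<nu> \<mu>) \<le> sqrt (\<integral>(x, y). (norm (y - x))\<^sup>2 \<partial>?\<pi>)" by (rule W2_le)
  also have "(\<integral>(x, y). (norm (y - x))\<^sup>2 \<partial>?\<pi>) = (\<integral>z. s\<^sup>2 * (norm (snd z - fst z))\<^sup>2 \<partial>(\<nu> \<Otimes>\<^sub>M \<mu>))"
  proof (subst integral_distr)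
    have "(1 - s) *\<^sub>R x + s *\<^sub>R y - x = s *\<^sub>R (y - x)" for x y :: 'a by (simp add: algebra_simps)
    then show "(\<integral>z. (case (fst z, (1 - s) *\<^sub>R fst z + s *\<^sub>R snd z) of (x, y) \<Rightarrow> (norm (y - x))\<^sup>2) \<partial>(\<nu> \<Otimes>\<^sub>M \<mu>))
        = (\<integral>z. s\<^sup>2 * (norm (snd z - fst z))\<^sup>2 \<partial>(\<nu> \<Otimes>\<^sub>M \<mu>))"
      by (simp add: power_mult_distrib)
  qed measurable
  also have "\<dots> = s\<^sup>2 * (\<integral>(x, y). (norm (y - x))\<^sup>2 \<partial>(\<nu> \<Otimes>\<^sub>M \<mu>))" by (simp add: split_def)
  finally show ?thesis using s by (simp add: real_sqrt_mult)
qed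

text \<open>
Average \<open>gibbs_second_moment\<close> over its centre \<open>x\<close>.
\<close>

lemma mean_square_distance_to_gibbs:
  fixes V :: "'a::euclidean_space \<Rightarrow> real"
  assumes V: "C2_function V" and hess: "\<And>x v. R * (norm v)\<^sup>2 \<le> hess V x v \<bullet> v" and R: "0 < R"
    and mass: "has_bochner_integral lborel (\<lambda>x. exp (- V x)) 1"
    and \<nu>: "\<nu> \<in> P2" "integrable \<nu> (\<lambda>x. (norm (grad V x))\<^sup>2)" "(\<integral>x. (norm (grad V x))\<^sup>2 \<partial>\<nu>) \<le> M"
  shows "(\<integral>(x, y). (norm (y - x))\<^sup>2 \<partial>(\<nu> \<Otimes>\<^sub>M gibbs V)) \<le> 4 / R * (2 ^ (DIM('a) + 1) + M / R)"
proof -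
  note P = \<nu>(1) gibbs_P2[OF V hess R mass]
  note D = couplingD[OF product_coupling[OF P] P]
  note [measurable_cong] = D(2)
  interpret N: prob_space \<nu> using \<nu> by (simp add: P2_def)
  interpret G: prob_space "gibbs V" by (rule gibbs_normalised(2)[OF mass])
  have "0 \<le> (\<integral>x. (norm (grad V x))\<^sup>2 \<partial>\<nu>)" by (rule Bochner_Integration.integral_nonneg) simp
  then have M: "0 \<le> M" using \<nu>(3) by linarith
  let ?h = "\<lambda>x. 4 / R * (2 ^ (DIM('a) + 1) + (norm (grad V x))\<^sup>2 / R)"
  have "ennreal (\<integral>(x, y). (norm (y - x))\<^sup>2 \<partial>(\<nu> \<Otimes>\<^sub>M gibbs V))
      = (\<integral>\<^sup>+z. ennreal ((norm (snd z - fst z))\<^sup>2) \<partial>(\<nu> \<Otimes>\<^sub>M gibbs V))"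
    using D(5) by (subst nn_integral_eq_integral) (auto simp: split_def)
  also have "\<dots> = (\<integral>\<^sup>+x. (\<integral>\<^sup>+z. ennreal ((norm (z - x))\<^sup>2) \<partial>gibbs V) \<partial>\<nu>)"
    by (subst G.nn_integral_fst[symmetric]) auto
  also have "\<dots> \<le> (\<integral>\<^sup>+x. ennreal (?h x) \<partial>\<nu>)"
    by (intro nn_integral_mono gibbs_second_moment V hess R mass)
  also have "\<dots> = ennreal (\<integral>x. ?h x \<partial>\<nu>)"
    using R \<nu>(2) by (intro nn_integral_eq_integral) auto
  also have "(\<integral>x. ?h x \<partial>\<nu>) = 4 / R * (2 ^ (DIM('a) + 1) + (\<integral>x. (norm (grad V x))\<^sup>2 \<partial>\<nu>) / R)"
    using \<nu>(2) by (simp add: N.prob_space)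
  also have "\<dots> \<le> 4 / R * (2 ^ (DIM('a) + 1) + M / R)"
    using R \<nu>(3) by (intro mult_left_mono add_left_mono divide_right_mono) auto
  finally show ?thesis using R M by (simp add: ennreal_leI ennreal_le_iff)
qed

text \<open>
The dual inequality is checked by Jensen's inequality on the product space. Write
\<open>T(x,z) = (1-s) x + s z\<close> and \<open>g = |\<nabla>V|\<^sup>2/(2R)\<close>. The function \<open>\<psi> = \<phi>(T) - (1-s) g(x) + n log s\<close> is chosen such that
\<open>exp(\<psi> - V(z)) \<le> s\<^sup>n exp(\<phi>(T) - V(T))\<close>. The change of variables \<open>y = T(x,z)\<close> for fixed \<open>x\<close> absorbs
\<open>s\<^sup>n\<close> and leaves \<open>\<integral>e\<^sup>\<psi> d(\<nu> \<otimes> \<mu>) \<le> \<integral>e\<^sup>\<phi> d\<mu>\<close>.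
\<close>

lemma rel_entropy_interpolant_le:
  fixes V :: "'a::euclidean_space \<Rightarrow> real"
  assumes V: "C2_function V" and hess: "\<And>x v. R * (norm v)\<^sup>2 \<le> hess V x v \<bullet> v" and R: "0 < R"
    and mass: "has_bochner_integral lborel (\<lambda>x. exp (- V x)) 1"
    and \<nu>: "\<nu> \<in> P2" "integrable \<nu> (\<lambda>x. (norm (grad V x))\<^sup>2)" "(\<integral>x. (norm (grad V x))\<^sup>2 \<partial>\<nu>) \<le> M"
    and s: "0 < s" "s \<le> 1"
  shows "rel_entropy (interpolant s \<nu> (gibbs V)) (gibbs V)
    \<le> ereal ((1 - s) * M / (2 * R) - real DIM('a) * ln s)"
proof (rule rel_entropy_le_if_lipschitz_variational_bound)
  note P = \<nu>(1) gibbs_P2[OF V hess R mass]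
  note D = couplingD[OF product_coupling[OF P] P]
  note [measurable_cong] = D(2)
  show pG: "prob_space (gibbs V)" by (rule gibbs_normalised(2)[OF mass])
  show "prob_space (interpolant s \<nu> (gibbs V))" "sets (interpolant s \<nu> (gibbs V)) = sets borel"
    using interpolant_P2[OF P, of s] s by (auto simp: P2_def)
  show "sets (gibbs V) = sets borel" by simp
  fix \<phi> :: "'a \<Rightarrow> real" and k L assume lip: "L-lipschitz_on UNIV \<phi>" and bd: "\<And>x. \<bar>\<phi> x\<bar> \<le> k"
  interpret N: prob_space \<nu> using \<nu> by (simp add: P2_def)
  interpret G: prob_space "gibbs V" by (rule pG)
  interpret prob_space "\<nu> \<Otimes>\<^sub>M gibbs V" by (rule D)
  note [measurable] = borel_measurable_lipschitz[OF lip] C2_borel_measurable[OF V]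
  have sN [measurable_cong]: "sets \<nu> = sets borel" using \<nu> by (simp add: P2_def)
  define n where "n = DIM('a)"
  define T where "T x z = (1 - s) *\<^sub>R x + s *\<^sub>R z" for x z :: 'a
  define g where "g x = (norm (grad V x))\<^sup>2 / (2 * R)" for x
  have gi: "integrable \<nu> g" unfolding g_def using \<nu>(2) by simp
  then have [measurable]: "g \<in> borel_measurable borel" by (auto dest: borel_measurable_integrable)
  have g0: "0 \<le> g x" for x using R by (simp add: g_def)
  have gM: "(\<integral>x. g x \<partial>\<nu>) \<le> M / (2 * R)" unfolding g_def using \<nu>(3) R by (simp add: divide_right_mono)
  have [measurable]: "(\<lambda>z. T (fst z) (snd z)) \<in> borel_measurable (borel \<Otimes>\<^sub>M borel)"
    unfolding T_def by measurable
  define \<psi> where "\<psi> z = \<phi> (T (fst z) (snd z)) - (1 - s) * g (fst z) + real n * ln s" for z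
  have [measurable]: "\<psi> \<in> borel_measurable (\<nu> \<Otimes>\<^sub>M gibbs V)" unfolding \<psi>_def by measurable
  have i\<phi>: "integrable (\<nu> \<Otimes>\<^sub>M gibbs V) (\<lambda>z. \<phi> (T (fst z) (snd z)))"
    by (rule integrable_const_bound[where B=k]) (use bd in auto)
  have ig: "integrable (\<nu> \<Otimes>\<^sub>M gibbs V) (\<lambda>z. g (fst z))"
    and eg: "(\<integral>z. g (fst z) \<partial>(\<nu> \<Otimes>\<^sub>M gibbs V)) = (\<integral>x. g x \<partial>\<nu>)"
  proof -
    have "integrable (distr (\<nu> \<Otimes>\<^sub>M gibbs V) borel fst) g" using gi D(3) by simp
    then show "integrable (\<nu> \<Otimes>\<^sub>M gibbs V) (\<lambda>z. g (fst z))"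
      by (subst (asm) integrable_distr_eq) auto
    have "(\<integral>x. g x \<partial>distr (\<nu> \<Otimes>\<^sub>M gibbs V) borel fst) = (\<integral>z. g (fst z) \<partial>(\<nu> \<Otimes>\<^sub>M gibbs V))"
      by (subst integral_distr) auto
    then show "(\<integral>z. g (fst z) \<partial>(\<nu> \<Otimes>\<^sub>M gibbs V)) = (\<integral>x. g x \<partial>\<nu>)" using D(3) by simp
  qed
  have e\<phi>: "(\<integral>z. \<phi> (T (fst z) (snd z)) \<partial>(\<nu> \<Otimes>\<^sub>M gibbs V)) = (\<integral>x. \<phi> x \<partial>interpolant s \<nu> (gibbs V))"
    unfolding interpolant_def T_def by (subst integral_distr) auto
  have i\<psi>: "integrable (\<nu> \<Otimes>\<^sub>M gibbs V) \<psi>" unfolding \<psi>_def using i\<phi> ig by auto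
  define m where "m = (\<integral>z. \<psi> z \<partial>(\<nu> \<Otimes>\<^sub>M gibbs V))"
  have m: "m = (\<integral>x. \<phi> x \<partial>interpolant s \<nu> (gibbs V)) - (1 - s) * (\<integral>x. g x \<partial>\<nu>) + real n * ln s"
    unfolding m_def \<psi>_def using i\<phi> ig by (simp add: eg e\<phi> prob_space)
  define Z where "Z = (\<integral>x. exp (\<phi> x) \<partial>gibbs V)"
  have iZ: "integrable (gibbs V) (\<lambda>x. exp (\<phi> x))"
    by (rule G.integrable_const_bound[where B="exp k"]) (use bd in \<open>auto simp: abs_le_iff\<close>)
  have Z: "(\<integral>\<^sup>+y. ennreal (exp (\<phi> y - V y)) \<partial>lborel) = ennreal Z"
  proof -
    have "ennreal Z = (\<integral>\<^sup>+x. ennreal (exp (\<phi> x)) \<partial>gibbs V)"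
      unfolding Z_def using iZ by (subst nn_integral_eq_integral) auto
    also have "\<dots> = (\<integral>\<^sup>+x. ennreal (exp (- V x)) * ennreal (exp (\<phi> x)) \<partial>lborel)"
      unfolding gibbs_def by (subst nn_integral_density) auto
    also have "\<dots> = (\<integral>\<^sup>+y. ennreal (exp (\<phi> y - V y)) \<partial>lborel)"
      by (intro nn_integral_cong) (simp add: ennreal_mult[symmetric] exp_add[symmetric])
    finally show ?thesis by simp
  qed
  have hess0: "0 \<le> hess V x v \<bullet> v" for x v
    using hess[of v x] R by (intro order_trans[OF _ hess]) simp
  have pw: "exp (- V z) * exp (\<psi> (x, z)) \<le> s ^ n * exp (\<phi> (T x z) - V (T x z))" for x z
  proof -
    have "V (T x z) \<le> V z + (1 - s) * (V x - V z)"
      using convex_if_hess_nonneg[OF V hess0, of s x z] s by (simp add: T_def algebra_simps)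
    also have "(1 - s) * (V x - V z) \<le> (1 - s) * g x"
      using energy_gap(1)[OF V hess R, of x z] s by (intro mult_left_mono) (auto simp: g_def)
    finally have "- V z + \<psi> (x, z) \<le> real n * ln s + (\<phi> (T x z) - V (T x z))"
      by (simp add: \<psi>_def)
    then have "exp (- V z + \<psi> (x, z)) \<le> exp (real n * ln s + (\<phi> (T x z) - V (T x z)))" by simp
    then show ?thesis by (simp only: exp_add exp_of_nat_mult exp_ln[OF s(1)])
  qed
  have "(\<integral>\<^sup>+z. ennreal (exp (\<psi> z)) \<partial>(\<nu> \<Otimes>\<^sub>M gibbs V)) = (\<integral>\<^sup>+x. (\<integral>\<^sup>+z. ennreal (exp (\<psi> (x, z))) \<partial>gibbs V) \<partial>\<nu>)"
    by (subst G.nn_integral_fst[symmetric]) auto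
  also have "\<dots> \<le> (\<integral>\<^sup>+x. ennreal Z \<partial>\<nu>)"
  proof (rule nn_integral_mono)
    fix x
    have "(\<integral>\<^sup>+z. ennreal (exp (\<psi> (x, z))) \<partial>gibbs V) = (\<integral>\<^sup>+z. ennreal (exp (- V z) * exp (\<psi> (x, z))) \<partial>lborel)"
      unfolding gibbs_def \<psi>_def T_def by (subst nn_integral_density) (auto simp: ennreal_mult)
    also have "\<dots> \<le> (\<integral>\<^sup>+z. ennreal (\<bar>s\<bar> ^ n) * ennreal (exp (\<phi> (T x z) - V (T x z))) \<partial>lborel)"
      using pw s by (intro nn_integral_mono) (simp add: ennreal_leI flip: ennreal_mult)
    also have "\<dots> = (\<integral>\<^sup>+y. ennreal (exp (\<phi> y - V y)) \<partial>lborel)"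
      unfolding T_def n_def using s by (intro nn_integral_lborel_affine[symmetric]) auto
    finally show "(\<integral>\<^sup>+z. ennreal (exp (\<psi> (x, z))) \<partial>gibbs V) \<le> ennreal Z" using Z by simp
  qed
  also have "\<dots> = ennreal Z" by (simp add: N.emeasure_space_1)
  finally have nn: "(\<integral>\<^sup>+z. ennreal (exp (\<psi> z)) \<partial>(\<nu> \<Otimes>\<^sub>M gibbs V)) \<le> ennreal Z" .
  have ie: "integrable (\<nu> \<Otimes>\<^sub>M gibbs V) (\<lambda>z. exp (\<psi> z))"
    by (rule integrableI_bounded) (use nn in \<open>auto simp: le_less_trans\<close>)
  have Z0: "0 \<le> Z" unfolding Z_def by (rule Bochner_Integration.integral_nonneg) simp
  \<comment> \<open>Jensen's inequality for the exponential, by its tangent line at the mean \<open>m\<close>.\<close>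
  have "exp m = (\<integral>z. exp m * (1 + (\<psi> z - m)) \<partial>(\<nu> \<Otimes>\<^sub>M gibbs V))"
    using i\<psi> by (simp add: prob_space flip: m_def)
  also have "\<dots> \<le> (\<integral>z. exp (\<psi> z) \<partial>(\<nu> \<Otimes>\<^sub>M gibbs V))"
  proof (rule integral_mono)
    fix z
    have "exp m * (1 + (\<psi> z - m)) \<le> exp m * exp (\<psi> z - m)"
      by (intro mult_left_mono exp_ge_add_one_self) simp
    then show "exp m * (1 + (\<psi> z - m)) \<le> exp (\<psi> z)" by (simp flip: exp_add)
  qed (use i\<psi> ie in auto)
  also have "\<dots> \<le> Z"
    using nn Z0 by (subst (asm) nn_integral_eq_integral[OF ie]) (auto simp: ennreal_le_iff)
  finally have "m \<le> ln Z" by (metis exp_gt_zero less_le_trans ln_exp ln_le_cancel_iff)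
  moreover have "(1 - s) * (\<integral>x. g x \<partial>\<nu>) \<le> (1 - s) * (M / (2 * R))"
    using gM s by (intro mult_left_mono) auto
  ultimately show "(\<integral>x. \<phi> x \<partial>interpolant s \<nu> (gibbs V))
      \<le> (1 - s) * M / (2 * R) - real DIM('a) * ln s + ln (\<integral>x. exp (\<phi> x) \<partial>gibbs V)"
    unfolding m by (simp add: Z_def n_def)
qed

section \<open>The entropy bound\<close>

text \<open>
The energy estimate for the flow with the interpolant as competitor.
\<close>

lemma entropy_bound_by_interpolation:
  fixes V :: "'a::euclidean_space \<Rightarrow> real"
  assumes V: "C2_function V" and hess: "\<And>x v. R * (norm v)\<^sup>2 \<le> hess V x v \<bullet> v" and R: "0 < R"
    and mass: "has_bochner_integral lborel (\<lambda>x. exp (- V x)) 1"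
    and flow: "fokker_planck_solution V R u"
    and init: "integrable (u 0) (\<lambda>x. (norm (grad V x))\<^sup>2)" "(\<integral>x. (norm (grad V x))\<^sup>2 \<partial>u 0) \<le> M"
    and s: "0 < s" "s \<le> 1" and t: "0 < t"
  shows "rel_entropy (u t) (gibbs V) \<le> ereal ((1 - s) * M / (2 * R) - real DIM('a) * ln s
      + s\<^sup>2 * (4 / R * (2 ^ (DIM('a) + 1) + M / R)) / (2 * t))"
proof -
  have u0: "u 0 \<in> P2" using flow by (simp add: fokker_planck_solution_def gradient_flow_def)
  note P = u0 gibbs_P2[OF V hess R mass]
  define v where "v = interpolant s (u 0) (gibbs V)"
  have v: "v \<in> P2" unfolding v_def using s by (intro interpolant_P2 P) auto
  let ?e = "(1 - s) * M / (2 * R) - real DIM('a) * ln s"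
  have "rel_entropy (u t) (gibbs V) \<le> ereal (?e + (W2 (u 0) v)\<^sup>2 / (2 * t))"
  proof (rule gradient_flow_energy_le[where X=P2 and d=W2 and l=R and \<phi>="\<lambda>\<nu>. rel_entropy \<nu> (gibbs V)"])
    show "gradient_flow P2 W2 (\<lambda>\<nu>. rel_entropy \<nu> (gibbs V)) R u"
      using flow by (simp add: fokker_planck_solution_def)
    show "rel_entropy v (gibbs V) \<le> ereal ?e"
      unfolding v_def by (rule rel_entropy_interpolant_le[OF V hess R mass u0 init s])
    show "rel_entropy y (gibbs V) \<le> ereal c"
      if "\<And>n. x n \<in> P2" "y \<in> P2" "(\<lambda>n. W2 (x n) y) \<longlonglongrightarrow> 0" "\<And>n. rel_entropy (x n) (gibbs V) \<le> ereal c"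
      for x :: "nat \<Rightarrow> 'a measure" and y c
      by (rule rel_entropy_lower_semicontinuous[OF gibbs_normalised(2)[OF mass] sets_gibbs that])
  qed (use R v t W2_nonneg W2_refl W2_commute W2_triangle in auto)
  moreover have "(W2 (u 0) v)\<^sup>2 \<le> s\<^sup>2 * (4 / R * (2 ^ (DIM('a) + 1) + M / R))"
  proof -
    let ?I = "\<integral>(x, y). (norm (y - x))\<^sup>2 \<partial>(u 0 \<Otimes>\<^sub>M gibbs V)"
    have I: "0 \<le> ?I" by (rule Bochner_Integration.integral_nonneg) (simp add: split_beta)
    have "(W2 (u 0) v)\<^sup>2 \<le> (s * sqrt ?I)\<^sup>2"
      unfolding v_def using s
      by (intro power_mono W2_interpolant_le P W2_nonneg) (use v in \<open>auto simp: v_def\<close>)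
    also have "\<dots> = s\<^sup>2 * ?I" using I by (simp add: power_mult_distrib)
    also have "\<dots> \<le> s\<^sup>2 * (4 / R * (2 ^ (DIM('a) + 1) + M / R))"
      by (intro mult_left_mono mean_square_distance_to_gibbs[OF V hess R mass u0 init]) simp
    finally show ?thesis .
  qed
  then have "?e + (W2 (u 0) v)\<^sup>2 / (2 * t)
      \<le> ?e + s\<^sup>2 * (4 / R * (2 ^ (DIM('a) + 1) + M / R)) / (2 * t)"
    using t by (intro add_left_mono divide_right_mono) auto
  ultimately show ?thesis by (meson ereal_less_eq(3) order_trans)
qed

text \<open>
Additive constants are absorbed in the constant inside the logarithm.
\<close>

lemma half_dim_ln_divide:
  assumes "0 < n" "0 < t" "exp (2 * a / real n) \<le> c"
  shows "a + real n / 2 * ln (1 / t) \<le> real n / 2 * ln (c / t)"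
proof -
  have c: "0 < c" using less_le_trans[OF exp_gt_zero assms(3)] .
  have "2 * a / real n \<le> ln c" using assms(3) c by (simp add: ln_ge_iff)
  then have "a \<le> real n / 2 * ln c" using assms(1) by (simp add: field_simps)
  then show ?thesis using assms(2) c by (simp add: ln_div algebra_simps)
qed

theorem proposition3p1:
  fixes R M :: real
  assumes "R > 0"
  shows "\<exists>c>0. \<forall>(V :: real ^ 'n \<Rightarrow> real) (u :: real \<Rightarrow> (real ^ 'n) measure) (T :: real).
           C2_function V
         \<and> has_bochner_integral lborel (\<lambda>x. exp (- V x)) 1
         \<and> (\<forall>x v. hess V x v \<bullet> v \<ge> R * (norm v)\<^sup>2)
         \<and> (\<exists>C. \<forall>x y. V (x + y) \<le> C * (1 + V x + V y))
         \<and> fokker_planck_solution V R u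
         \<and> T > 0
         \<and> (\<forall>t\<in>{0..T}. integrable (u t) (\<lambda>x. (norm (grad V x))\<^sup>2)
                      \<and> (\<integral>x. (norm (grad V x))\<^sup>2 \<partial>u t) \<le> M)
         \<longrightarrow> (\<forall>t. 0 < t \<and> t \<le> T \<longrightarrow>
               rel_entropy (u t) (gibbs V)
                 \<le> ereal (max 1 (real CARD('n) / 2 * ln (c / t))))"
proof -
  let ?n = "CARD('n)"
  define K where "K = 4 / R * (2 ^ (?n + 1) + M / R)"
  define c where "c = max (exp (2 * (M / (2 * R) + K / 2) / real ?n)) (K / 2 * exp (2 * (K / 2) / real ?n))"
  have c0: "0 < c" by (simp add: c_def less_max_iff_disj)
  show ?thesis
  proof (intro exI[of _ c] conjI allI impI c0; elim conjE)
    fix V :: "real ^ 'n \<Rightarrow> real" and u :: "real \<Rightarrow> (real ^ 'n) measure" and T t :: real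
    assume V: "C2_function V" and mass: "has_bochner_integral lborel (\<lambda>x. exp (- V x)) 1"
      and hess: "\<forall>x v. hess V x v \<bullet> v \<ge> R * (norm v)\<^sup>2"
      and flow: "fokker_planck_solution V R u" and T: "T > 0"
      and grad: "\<forall>t\<in>{0..T}. integrable (u t) (\<lambda>x. (norm (grad V x))\<^sup>2)
                      \<and> (\<integral>x. (norm (grad V x))\<^sup>2 \<partial>u t) \<le> M"
      and t: "0 < t" "t \<le> T"
    have init: "integrable (u 0) (\<lambda>x. (norm (grad V x))\<^sup>2)" "(\<integral>x. (norm (grad V x))\<^sup>2 \<partial>u 0) \<le> M"
      using grad T by auto
    have "0 \<le> (\<integral>x. (norm (grad V x))\<^sup>2 \<partial>u 0)"
      by (rule Bochner_Integration.integral_nonneg) simp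
    then have M: "0 \<le> M" using init(2) by linarith
    have K: "0 < K" unfolding K_def
      by (intro mult_pos_pos add_pos_nonneg divide_nonneg_nonneg divide_pos_pos zero_less_power)
        (use assms M in simp_all)
    have bound: "rel_entropy (u t) (gibbs V)
        \<le> ereal ((1 - s) * M / (2 * R) - real ?n * ln s + s\<^sup>2 * K / (2 * t))" if "0 < s" "s \<le> 1" for s
      using entropy_bound_by_interpolation[OF V _ assms mass flow init that t(1)] hess
      by (simp add: K_def)
    \<comment> \<open>For \<open>1 < t < K/2\<close> the value \<open>K/(2t)\<close> may exceed \<open>1\<close>; the second term of \<open>c\<close> is made for this range.\<close>
    consider "t \<le> 1" | "1 < t" "t < K / 2" | "1 < t" "K / 2 \<le> t" by linarith
    then have "\<exists>s. 0 < s \<and> s \<le> 1 \<and> (1 - s) * M / (2 * R) - real ?n * ln s + s\<^sup>2 * K / (2 * t)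
        \<le> max 1 (real ?n / 2 * ln (c / t))"
    proof cases
      case 1
      have "(1 - sqrt t) * M / (2 * R) \<le> 1 * M / (2 * R)"
        using M t assms by (intro divide_right_mono mult_right_mono) auto
      moreover have "(sqrt t)\<^sup>2 * K / (2 * t) = K / 2" using t by simp
      moreover have "real ?n * ln (sqrt t) = - (real ?n / 2 * ln (1 / t))"
        using t by (simp add: ln_sqrt ln_div)
      moreover have "M / (2 * R) + K / 2 + real ?n / 2 * ln (1 / t) \<le> real ?n / 2 * ln (c / t)"
        using t by (intro half_dim_ln_divide) (auto simp: c_def)
      ultimately show ?thesis using t 1 by (intro exI[of _ "sqrt t"]) auto
    next
      case 2
      have "K / 2 \<le> real ?n / 2 * ln (c / t)"
      proof -
        have "exp (2 * (K / 2) / real ?n) * t \<le> exp (2 * (K / 2) / real ?n) * (K / 2)"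
          using 2 by (intro mult_left_mono) auto
        also have "\<dots> \<le> c" unfolding c_def by (rule max.coboundedI2) (simp only: mult.commute order_refl)
        finally have "exp (2 * (K / 2) / real ?n) \<le> c / t" using t by (simp add: pos_le_divide_eq)
        from half_dim_ln_divide[OF _ _ this, of 1] show ?thesis by simp
      qed
      moreover have "K / (2 * t) \<le> K / 2" using K 2 by (simp add: field_simps)
      ultimately show ?thesis by (intro exI[of _ 1]) auto
    next
      case 3
      then have "K / (2 * t) \<le> 1" by (simp add: field_simps)
      then show ?thesis by (intro exI[of _ 1]) auto
    qed
    then show "rel_entropy (u t) (gibbs V) \<le> ereal (max 1 (real ?n / 2 * ln (c / t)))"
      using bound by (meson ereal_less_eq(3) order_trans)
  qed
qed

end
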